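(* Let $n \geq 1$ and let $\mathbf{x} = (x_1,\ldots,x_n) \in \mathbb{N}^n$. Then, as an identity of polynomials in the indeterminate $q$, \[ \sum_{\alpha \in \mathrm{PF}(\mathbf{x})} q^{\mathrm{rsum}(\alpha)} = \sum_{T \in \mathrm{RPT}(n+1)} \left(\sum_{\prec \in \mathrm{AVO}(T)}q^{\sum_{(i,j)\colon i \leq_T j,\ j \prec i} \; x_{\mathrm{par}_T(i)+1}}\right) \left(\prod_{i=1}^{n} [x_i]_q^{\mathrm{outdeg}_T(i-1)}\right),\] where the sum in the exponent ranges over all pairs $(i,j)$ of non-root vertices of $T$ with $i \leq_T j$ and $j \prec i$, and where $\mathrm{outdeg}_T(i) := \#\{j \in V(T) \colon i = \mathrm{par}_T(j)\}$ is the number of children of $i$ in $T$.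
   Context: $\mathbb{N} = \{0,1,2,\ldots\}$. For $k \in \mathbb{N}$, $[k]_q := 1+q+\cdots+q^{k-1}$ (so $[0]_q = 0$, and any zeroth power equals $1$). Vector parking functions: for $\mathbf{x} = (x_1,\ldots,x_n) \in \mathbb{N}^n$, an $\mathbf{x}$-parking function is a sequence $\alpha = (\alpha_1,\ldots,\alpha_n) \in \mathbb{N}^n$ whose weakly increasing rearrangement $\alpha_{i_1} \leq \cdots \leq \alpha_{i_n}$ satisfies $\alpha_{i_j} \leq \left(\sum_{k=1}^{j} x_k\right) - 1$ for all $1 \leq j \leq n$. The set of these is $\mathrm{PF}(\mathbf{x})$. The reversed sum of $\alpha \in \mathrm{PF}(\mathbf{x})$ is $\mathrm{rsum}(\alpha) := \left(\sum_{i=1}^{n} (n+1-i)x_i\right) - n - \sum_{i=1}^n \alpha_i$. Trees: a rooted tree $T$ with vertex set $V(T)$ carries the partial order $\leq_T$ on $V(T)$ where $i \leq_T j$ iff the unique path in $T$ from $j$ to the root passes through $i$ (so ancestors are smaller and the root is minimal). For a non-root vertex $j$, $\mathrm{par}_T(j)$ is its parent; two non-root vertices $i,j$ are siblings if $\mathrm{par}_T(i) = \mathrm{par}_T(j)$. A rooted plane tree on $n+1$ vertices is a rooted tree $T$ with vertex set $\{0,1,\ldots,n\}$ and root $0$ such that: (1) $i \leq_T j$ implies $i \leq j$ for all $1 \leq i,j \leq n$; (2) $i \leq_T k$ implies $i \leq_T j$ for all $1 \leq i<j<k \leq n$. The set of these is $\mathrm{RPT}(n+1)$. For $T \in \mathrm{RPT}(n+1)$,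 an admissible vertex order of $T$ is a total order $\prec$ on $V(T) - \{0\} = \{1,\ldots,n\}$ such that whenever $1 \leq i < j \leq n$ are siblings in $T$, we have $j \prec i$. The set of these is $\mathrm{AVO}(T)$. *)

theory Defs
  imports "HOL-Computational_Algebra.Polynomial"
begin

subsection \<open>Vector parking functions\<close>

text \<open>
  A vector \<open>(x_1, ..., x_n)\<close> of natural numbers is a function \<open>x\<close> of which only the values at
  \<open>1, ..., n\<close> are used. A sequence \<open>\<alpha>\<close> is a list, so its entries are indexed from \<open>0\<close>. The bound is
  stated over the integers: with truncated subtraction a bound of \<open>-1\<close> would turn into \<open>0\<close>.
\<close>

definition PF :: "nat \<Rightarrow> (nat \<Rightarrow> nat) \<Rightarrow> nat list set" where
  "PF n x = {\<alpha>. length \<alpha> = n \<and>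
     (\<forall>j\<in>{1..n}. int (sort \<alpha> ! (j - 1)) \<le> int (\<Sum>k=1..j. x k) - 1)}"

definition rsum :: "nat \<Rightarrow> (nat \<Rightarrow> nat) \<Rightarrow> nat list \<Rightarrow> int" where
  "rsum n x \<alpha> = (\<Sum>i=1..n. (int n + 1 - int i) * int (x i)) - int n - int (sum_list \<alpha>)"

text \<open>Hence no information is lost when \<open>rsum\<close> is converted to a natural number exponent.\<close>

lemma rsum_nonneg:
  assumes "\<alpha> \<in> PF n x"
  shows "rsum n x \<alpha> \<ge> 0"
proof -
  have len: "length \<alpha> = n"
    and bd: "\<And>j. j \<in> {1..n} \<Longrightarrow> int (sort \<alpha> ! (j - 1)) \<le> int (\<Sum>k=1..j. x k) - 1"
    using assms by (auto simp: PF_def)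
  have "sum_list \<alpha> = sum_list (sort \<alpha>)"
    by (metis mset_sort sum_mset_sum_list)
  also have "\<dots> = (\<Sum>j=1..n. sort \<alpha> ! (j - 1))"
    by (simp add: sum_list_sum_nth len atLeast0LessThan sum.atLeast1_atMost_eq)
  finally have "int (sum_list \<alpha>) = (\<Sum>j=1..n. int (sort \<alpha> ! (j - 1)))"
    by simp
  also have "\<dots> \<le> (\<Sum>j=1..n. int (\<Sum>k=1..j. x k) - 1)"
    by (intro sum_mono bd)
  also have "\<dots> = (\<Sum>j=1..n. int (\<Sum>k=1..j. x k)) - int n"
    by (simp add: sum_subtractf)
  also have "(\<Sum>j=1..n. int (\<Sum>k=1..j. x k)) = (\<Sum>i=1..n. (int n + 1 - int i) * int (x i))"
  proof (induction n)
    case (Suc n)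
    have "(\<Sum>i=1..Suc n. (int (Suc n) + 1 - int i) * int (x i)) =
          (\<Sum>i=1..n. (int n + 1 - int i) * int (x i)) + (\<Sum>i=1..Suc n. int (x i))"
      by (simp add: sum.distrib[symmetric] algebra_simps)
    with Suc show ?case by simp
  qed simp
  finally show ?thesis
    by (simp add: rsum_def)
qed

subsection \<open>Trees rooted at \<open>0\<close>\<close>

text \<open>A tree is given by its set of (undirected) edges, which are two-element sets of vertices.\<close>

definition is_path :: "nat set set \<Rightarrow> nat list \<Rightarrow> nat \<Rightarrow> nat \<Rightarrow> bool" where
  "is_path E p u v \<longleftrightarrow> p \<noteq> [] \<and> distinct p \<and> hd p = u \<and> last p = v \<and>
     (\<forall>i. Suc i < length p \<longrightarrow> {p ! i, p ! Suc i} \<in> E)"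

definition is_tree :: "nat set \<Rightarrow> nat set set \<Rightarrow> bool" where
  "is_tree V E \<longleftrightarrow> V \<noteq> {} \<and> (\<forall>e\<in>E. e \<subseteq> V \<and> card e = 2) \<and>
     (\<forall>u\<in>V. \<forall>v\<in>V. \<exists>!p. is_path E p u v)"

definition path_to_root :: "nat set set \<Rightarrow> nat \<Rightarrow> nat list" where
  "path_to_root T j = (THE p. is_path T p j 0)"

definition tree_le :: "nat set set \<Rightarrow> nat \<Rightarrow> nat \<Rightarrow> bool" where
  "tree_le T i j \<longleftrightarrow> i \<in> set (path_to_root T j)"

text \<open>The parent is only meaningful for a non-root vertex, whose path to the root has at least two
  entries.\<close>

definition par :: "nat set set \<Rightarrow> nat \<Rightarrow> nat" where
  "par T j = path_to_root T j ! 1"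

text \<open>In the following, \<open>n\<close> is the number of non-root vertices; the vertex set is \<open>{0..n}\<close>.\<close>

definition outdeg :: "nat \<Rightarrow> nat set set \<Rightarrow> nat \<Rightarrow> nat" where
  "outdeg n T i = card {j\<in>{1..n}. par T j = i}"

definition rooted_plane_trees :: "nat \<Rightarrow> nat set set set" where
  "rooted_plane_trees n = {T. is_tree {0..n} T \<and>
     (\<forall>i\<in>{1..n}. \<forall>j\<in>{1..n}. tree_le T i j \<longrightarrow> i \<le> j) \<and>
     (\<forall>i\<in>{1..n}. \<forall>j\<in>{1..n}. \<forall>k\<in>{1..n}.
        i < j \<and> j < k \<and> tree_le T i k \<longrightarrow> tree_le T i j)}"

text \<open>A total order \<open>\<prec>\<close> is the relation \<open>r\<close> with \<open>(a, b) \<in> r\<close> iff \<open>a \<prec> b\<close>.\<close>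

definition AVO :: "nat \<Rightarrow> nat set set \<Rightarrow> nat rel set" where
  "AVO n T = {r. r \<subseteq> {1..n} \<times> {1..n} \<and> strict_linear_order_on {1..n} r \<and>
     (\<forall>i\<in>{1..n}. \<forall>j\<in>{1..n}. i < j \<and> par T i = par T j \<longrightarrow> (j, i) \<in> r)}"

subsection \<open>Polynomials in the indeterminate \<open>q\<close>\<close>

definition qvar :: "int poly" where
  "qvar = [:0, 1:]"

definition qint :: "nat \<Rightarrow> int poly" where
  "qint k = (\<Sum>i<k. qvar ^ i)"

end

theory Submission
  imports Defs "HOL-Library.FuncSet"
begin

text \<open>
  The proof partitions the parking functions according to the run of a depth-first burning process,
  and sums over each part.

  Regard the entry \<open>\<alpha> ! c\<close> as a counter of the label \<open>c\<close>. The process builds a tree from the root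
  \<open>0\<close>; its vertices are numbered in the order of their visit, and every other vertex \<open>j\<close> carries a
  label \<open>v j\<close>. The current vertex \<open>u\<close> examines the unvisited labels in decreasing order. If the
  counter of \<open>c\<close> is less than \<open>x (u + 1)\<close>, then \<open>c\<close> is caught: it is the label of the next vertex, a
  child of \<open>u\<close>, where the search goes on. Otherwise \<open>x (u + 1)\<close> is subtracted from the counter and
  \<open>u\<close> examines the next label. When \<open>u\<close> has no labels left, the search returns to its parent. The
  tree is a rooted plane tree, because the numbering is a preorder, and comparing labels gives a
  total order \<open>\<prec>\<close> that is admissible, because the labels of siblings decrease.

  The parking condition says that for each \<open>m < n\<close> more than \<open>m\<close> counters start below
  \<open>x 1 + ... + x (m + 1)\<close>. Hence, with \<open>m\<close> labels visited, some unvisited label cannot survive the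
  examination by all of the vertices \<open>0, ..., m\<close>, and the search visits everything
  (\<open>burning_exists\<close>). The run is determined by \<open>\<alpha>\<close> (\<open>burning_unique\<close>), and the runs have
  exactly the shape of a plane tree with an admissible order (\<open>dfs_run_iff\<close>).

  Now fix the run. The vertices before \<open>j\<close> that do not examine \<open>v j\<close> in vain are the parent of \<open>j\<close>,
  which catches it, and each vertex that went down from some child \<open>i\<close> to \<open>j\<close> before it reached the
  smaller label \<open>v j\<close>, that is, the parents of those ancestors \<open>i\<close> of \<open>j\<close> with \<open>j \<prec> i\<close>. Therefore
  \<open>x 1 + ... + x j - 1 - \<alpha> ! v j\<close> is the sum of \<open>x (par i + 1)\<close> over these \<open>i\<close> plus a number that
  ranges freely over \<open>{..<x (par j + 1)}\<close>. These differences add up to \<open>rsum n x \<alpha>\<close> over all \<open>j\<close>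
  (\<open>rsum_eq_sum_slack\<close>). The sums over \<open>i\<close> yield the exponent of \<open>q\<close> for the run, and
  the free numbers yield one factor \<open>[x (par j + 1)]\<close> for each \<open>j\<close> (\<open>sum_run_box\<close>).

  In the formal text the process appears through inequalities that a run has to satisfy. Instead of
  the weights already subtracted from a counter, they use those still pending: with \<open>K\<close> the total
  weight of the visited vertices, a counter \<open>a\<close> has survived so far iff \<open>K\<close> is at most \<open>a\<close> plus the
  pending weights.
\<close>

section \<open>Ancestors of a parent function\<close>

definition parents_smaller :: "nat \<Rightarrow> (nat \<Rightarrow> nat) \<Rightarrow> bool" where
  "parents_smaller n f \<longleftrightarrow> (\<forall>j\<in>{1..n}. f j < j)"

lemma parents_smallerD: "parents_smaller n f \<Longrightarrow> 0 < j \<Longrightarrow> j \<le> n \<Longrightarrow> f j < j"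
  by (auto simp: parents_smaller_def)

text \<open>
  The value of the parent function at the root \<open>0\<close> is junk, so a chain of ancestors stops there.
\<close>

inductive anc :: "(nat \<Rightarrow> nat) \<Rightarrow> nat \<Rightarrow> nat \<Rightarrow> bool" for f where
  anc_refl: "anc f j j"
| anc_parent: "0 < j \<Longrightarrow> anc f i (f j) \<Longrightarrow> anc f i j"

lemma anc_unfold: "anc f i j \<longleftrightarrow> i = j \<or> 0 < j \<and> anc f i (f j)"
  by (subst anc.simps) auto

lemma anc_0_iff [simp]: "anc f i 0 \<longleftrightarrow> i = 0"
  by (subst anc_unfold) auto

lemma anc_trans: "anc f j k \<Longrightarrow> anc f i j \<Longrightarrow> anc f i k"
  by (induction rule: anc.induct) (auto intro: anc_parent)

lemma anc_linear: "anc f j k \<Longrightarrow> anc f i k \<Longrightarrow> anc f i j \<or> anc f j i"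
proof (induction rule: anc.induct)
  case (anc_parent k j)
  have "anc f j k" using anc_parent.hyps by (rule anc.anc_parent)
  moreover have "i = k \<or> anc f i (f k)" using anc_parent.prems anc_unfold[of f i k] by blast
  ultimately show ?case using anc_parent.IH by blast
qed simp

lemma anc_le:
  assumes "parents_smaller n f"
  shows "anc f i j \<Longrightarrow> j \<le> n \<Longrightarrow> i \<le> j"
proof (induction rule: anc.induct)
  case (anc_parent j i)
  then show ?case using parents_smallerD[OF assms, of j] by simp
qed simp

lemma anc_root:
  assumes "parents_smaller n f"
  shows "j \<le> n \<Longrightarrow> anc f 0 j"
proof (induction j rule: less_induct)
  case (less j)
  then show ?case using parents_smallerD[OF assms, of j]
    by (cases "j = 0") (auto intro: anc_refl anc_parent)
qed

lemma anc_cong: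
  assumes "parents_smaller n f" "\<And>j. 0 < j \<Longrightarrow> j \<le> n \<Longrightarrow> f j = g j"
  shows "j \<le> n \<Longrightarrow> anc f i j \<longleftrightarrow> anc g i j"
proof (induction j rule: less_induct)
  case (less j)
  show ?case
  proof (cases "j = 0")
    case False
    then have "f j = g j" "f j < j" using parents_smallerD[OF assms(1), of j] assms(2)[of j] less.prems by auto
    then show ?thesis
      using less.IH[of "f j"] less.prems anc_unfold[of f i j] anc_unfold[of g i j] by auto
  qed simp
qed

lemma anc_toward_child:
  "anc f u m \<Longrightarrow> u \<noteq> m \<Longrightarrow> \<exists>i. 0 < i \<and> anc f i m \<and> f i = u"
proof (induction rule: anc.induct)
  case (anc_parent j u)
  then show ?case
    by (cases "u = f j") (auto intro: anc.intros)
qed simp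

text \<open>
  Both \<open>i\<close> and \<open>w\<close> lie on the chain from \<open>m\<close> to the root. If \<open>i\<close> were a proper descendant of
  \<open>w\<close>, then its parent would be \<open>w\<close> or a descendant of \<open>w\<close>, hence at least \<open>w\<close>.
\<close>

lemma anc_parent_less_imp:
  assumes dec: "parents_smaller n f"
    and "m \<le> n" "anc f i m" "0 < i" "anc f w m" "f i < w"
  shows "anc f i w"
proof (rule ccontr)
  assume "\<not> anc f i w"
  then have "anc f w i" "w \<noteq> i"
    using anc_linear[OF assms(5,3)] anc_refl by auto
  then have "anc f w (f i)"
    by (metis anc_unfold)
  moreover have "f i \<le> n"
    using parents_smallerD[OF dec, of i] anc_le[OF dec assms(3,2)] assms(2,4) by simp
  ultimately show False
    using anc_le[OF dec, of w "f i"] assms(6) by simp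
qed

lemma parent_inj_on_anc:
  assumes dec: "parents_smaller n f" and "j \<le> n"
  shows "inj_on f {i. 0 < i \<and> anc f i j}"
proof -
  have "i = k" if "0 < i" "anc f i j" "0 < k" "anc f k j" "f i = f k" "anc f i k" for i k
  proof (rule ccontr)
    assume "i \<noteq> k"
    then have "anc f i (f k)" using that(6) by (metis anc_unfold)
    moreover have "k \<le> n" "i \<le> n"
      using anc_le[OF dec, of i j] anc_le[OF dec, of k j] that assms(2) by auto
    moreover have "f k < k" "f i < i"
      using parents_smallerD[OF dec, of i] parents_smallerD[OF dec, of k] that \<open>k \<le> n\<close> \<open>i \<le> n\<close> by simp_all
    ultimately show False using anc_le[OF dec, of i "f k"] that(5) by simp
  qed
  note less = this
  show ?thesis
  proof (rule inj_onI)
    fix i k assume "i \<in> {i. 0 < i \<and> anc f i j}" "k \<in> {i. 0 < i \<and> anc f i j}" "f i = f k"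
    then show "i = k"
      using anc_linear[of f k j i] less[of i k] less[of k i] by auto
  qed
qed

text \<open>
  In preorder the next vertex hangs off the path from the current vertex to the root. This local
  rule already forces parents to be smaller than their children, and the descendants of each vertex
  to form an interval.
\<close>

definition plane_parent :: "nat \<Rightarrow> (nat \<Rightarrow> nat) \<Rightarrow> bool" where
  "plane_parent n f \<longleftrightarrow> (\<forall>m<n. anc f (f (Suc m)) m)"

lemma plane_parent_parents_smaller:
  assumes "plane_parent n f"
  shows "parents_smaller n f"
proof -
  have "0 < j \<Longrightarrow> j \<le> n \<Longrightarrow> f j < j" for j
  proof (induction j rule: less_induct)
    case (less j)
    then obtain m where m: "j = Suc m" by (metis gr0_implies_Suc)
    have "anc f (f j) m"
      using assms less.prems m by (auto simp: plane_parent_def)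
    then have "f j \<le> m"
      by (rule anc_le[of m f, rotated]) (use less m in \<open>auto simp: parents_smaller_def\<close>)
    then show ?case using m by simp
  qed
  then show ?thesis by (simp add: parents_smaller_def)
qed

lemma plane_parent_convex:
  assumes "plane_parent n f" "k \<le> n" "anc f i k" "i \<le> j" "j \<le> k"
  shows "anc f i j"
  using assms(2-5)
proof (induction k)
  case (Suc k)
  show ?case
  proof (cases "j = Suc k")
    case False
    then have "anc f i (f (Suc k))" using Suc.prems by (metis anc_unfold le_antisym)
    moreover have "anc f (f (Suc k)) k"
      using assms(1) Suc.prems(1) by (auto simp: plane_parent_def)
    ultimately have "anc f i k" by (rule anc_trans[rotated])
    then show ?thesis using Suc False by simp
  qed (use Suc in simp)
qed simp

section \<open>Trees as edge sets and as parent functions\<close>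

lemma is_path_singleton [simp]: "is_path E [a] u v \<longleftrightarrow> a = u \<and> a = v"
  by (auto simp: is_path_def)

lemma is_path_Cons:
  assumes "p \<noteq> []"
  shows "is_path E (a # p) u v \<longleftrightarrow>
    a = u \<and> a \<notin> set p \<and> {a, hd p} \<in> E \<and> is_path E p (hd p) v"
proof -
  have "(\<forall>i. Suc i < length (a # p) \<longrightarrow> {(a # p) ! i, (a # p) ! Suc i} \<in> E) \<longleftrightarrow>
    {a, hd p} \<in> E \<and> (\<forall>i. Suc i < length p \<longrightarrow> {p ! i, p ! Suc i} \<in> E)"
    (is "?L \<longleftrightarrow> ?R")
  proof
    assume L: ?L
    show ?R
      using L[rule_format, of 0] L[rule_format, of "Suc _"] assms
      by (auto simp: hd_conv_nth)
  next
    assume ?R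
    then show ?L
      using assms by (auto simp: hd_conv_nth nth_Cons' gr0_conv_Suc)
  qed
  then show ?thesis
    using assms by (auto simp: is_path_def)
qed

lemma is_path_ends:
  assumes "is_path E p u v"
  shows "p \<noteq> []" "hd p = u" "last p = v" "u \<in> set p" "v \<in> set p"
  using assms hd_in_set[of p] last_in_set[of p] by (auto simp: is_path_def)

lemma is_path_same: "is_path E p u u \<longleftrightarrow> p = [u]"
proof (cases p)
  case (Cons a q)
  then show ?thesis
    by (cases "q = []") (auto simp: is_path_def)
qed (simp add: is_path_def)

lemma is_path_rev: "is_path E p u v \<Longrightarrow> is_path E (rev p) v u"
  unfolding is_path_def
proof (elim conjE, intro conjI allI impI)
  fix i
  assume edges: "\<forall>i. Suc i < length p \<longrightarrow> {p ! i, p ! Suc i} \<in> E" and "Suc i < length (rev p)"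
  then have i: "Suc i < length p" "Suc (length p - Suc (Suc i)) = length p - Suc i" by auto
  then have "{p ! (length p - Suc (Suc i)), p ! (length p - Suc i)} \<in> E"
    using edges[rule_format, of "length p - Suc (Suc i)"] by simp
  then show "{rev p ! i, rev p ! Suc i} \<in> E"
    using i by (simp add: rev_nth insert_commute)
qed (auto simp: hd_rev last_rev)

lemma is_path_mono: "is_path E p u v \<Longrightarrow> E \<subseteq> E' \<Longrightarrow> is_path E' p u v"
  by (auto simp: is_path_def)

lemma is_path_Cons_cases:
  assumes "is_path E p u v" "u \<noteq> v"
  obtains q where "p = u # q" "q \<noteq> []" "u \<notin> set q" "{u, hd q} \<in> E" "is_path E q (hd q) v"
proof (cases p)
  case Nil
  then show ?thesis using assms by (simp add: is_path_def)
next
  case (Cons a q)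
  have "q \<noteq> []" using Cons assms by auto
  then have "a = u" "a \<notin> set q" "{a, hd q} \<in> E" "is_path E q (hd q) v"
    using assms(1) unfolding Cons is_path_Cons[OF \<open>q \<noteq> []\<close>] by blast+
  with that[of q] Cons \<open>q \<noteq> []\<close> show ?thesis by simp
qed

text \<open>
  An inner vertex of a path has two distinct neighbours on it, but the leaf \<open>a\<close> has only the
  neighbour \<open>b\<close>.
\<close>

lemma is_path_avoids_leaf:
  assumes "is_path (insert {a, b} E) p u v" "u \<noteq> a" "v \<noteq> a" and a: "\<And>e. e \<in> E \<Longrightarrow> a \<notin> e"
  shows "a \<notin> set p \<and> is_path E p u v"
proof -
  have edges: "\<And>i. Suc i < length p \<Longrightarrow> {p ! i, p ! Suc i} \<in> insert {a, b} E"
    and p: "p \<noteq> []" "distinct p" "hd p = u" "last p = v"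
    using assms(1) by (auto simp: is_path_def)
  have nb: "p ! i = b" if "{p ! i, a} \<in> insert {a, b} E" "p ! i \<noteq> a" for i
    using that a[of "{p ! i, a}"] by (auto simp: doubleton_eq_iff)
  have notin: "a \<notin> set p"
  proof
    assume "a \<in> set p"
    then obtain i where i: "i < length p" "p ! i = a" by (auto simp: in_set_conv_nth)
    have "i \<noteq> 0" using i p assms(2) by (metis hd_conv_nth)
    then obtain k where k: "i = Suc k" using not0_implies_Suc by blast
    have "Suc i < length p"
    proof (rule ccontr)
      assume "\<not> Suc i < length p"
      then have "i = length p - 1" using i(1) by simp
      then show False using i p assms(3) by (simp add: last_conv_nth)
    qed
    then have "p ! k \<noteq> p ! i" "p ! Suc i \<noteq> p ! i" and ne: "p ! k \<noteq> p ! Suc i"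
      using k p(2) by (simp_all add: nth_eq_iff_index_eq)
    moreover have "{p ! k, a} \<in> insert {a, b} E" "{p ! Suc i, a} \<in> insert {a, b} E"
      using edges[of k] edges[of i] i k \<open>Suc i < length p\<close> by (simp_all add: insert_commute)
    ultimately have "p ! k = b" "p ! Suc i = b"
      using nb[of k] nb[of "Suc i"] i(2) by simp_all
    with ne show False by simp
  qed
  have "{p ! i, p ! Suc i} \<in> E" if "Suc i < length p" for i
  proof -
    have "p ! i \<noteq> a" "p ! Suc i \<noteq> a" using notin that by (auto simp: in_set_conv_nth)
    then show ?thesis using edges[OF that] by (auto simp: doubleton_eq_iff)
  qed
  with notin p show ?thesis by (auto simp: is_path_def)
qed

lemma is_tree_add_leaf:
  assumes tree: "is_tree V E" and "a \<notin> V" "b \<in> V"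
  shows "is_tree (insert a V) (insert {a, b} E)"
proof -
  let ?E = "insert {a, b} E"
  have ne: "\<And>e. e \<in> E \<Longrightarrow> a \<notin> e" and edges: "\<And>e. e \<in> E \<Longrightarrow> e \<subseteq> V \<and> card e = 2"
    using assms by (auto simp: is_tree_def)
  have uniq: "\<exists>!p. is_path E p u v" if "u \<in> V" "v \<in> V" for u v
    using tree that unfolding is_tree_def by blast
  have old: "is_path ?E p u v \<longleftrightarrow> is_path E p u v"
    and avoid: "is_path E p u v \<Longrightarrow> a \<notin> set p" if "u \<in> V" "v \<in> V" for u v p
  proof -
    have "u \<noteq> a" "v \<noteq> a" using that assms(2) by auto
    then have "is_path ?E p u v \<Longrightarrow> a \<notin> set p \<and> is_path E p u v"
      using ne by (intro is_path_avoids_leaf[of a b E p u v])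
    moreover have "is_path E p u v \<Longrightarrow> is_path ?E p u v"
      by (rule is_path_mono) auto
    ultimately show "is_path ?E p u v \<longleftrightarrow> is_path E p u v" "is_path E p u v \<Longrightarrow> a \<notin> set p"
      by blast+
  qed
  have from_leaf: "is_path ?E p a v \<longleftrightarrow> (\<exists>q. p = a # q \<and> is_path E q b v)" if "v \<in> V" for v p
  proof
    assume p: "is_path ?E p a v"
    have "a \<noteq> v" using that assms(2) by auto
    from p this obtain q where q: "p = a # q" "q \<noteq> []" "{a, hd q} \<in> ?E" "is_path ?E q (hd q) v"
      by (rule is_path_Cons_cases)
    then have "hd q = b"
      using ne[of "{a, hd q}"] by (auto simp: doubleton_eq_iff)
    with q old[OF assms(3) that] show "\<exists>q. p = a # q \<and> is_path E q b v" by auto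
  next
    assume "\<exists>q. p = a # q \<and> is_path E q b v"
    then obtain q where q: "p = a # q" "is_path E q b v" by blast
    then have "q \<noteq> []" "hd q = b" by (auto simp: is_path_def)
    then show "is_path ?E p a v"
      using q avoid[OF assms(3) that q(2)] is_path_mono[OF q(2), of ?E]
      by (auto simp: is_path_Cons)
  qed
  have leaf1: "\<exists>!p. is_path ?E p a v" if "v \<in> V" for v
    using uniq[OF assms(3) that] unfolding from_leaf[OF that] by blast
  have leaf2: "\<exists>!p. is_path ?E p v a" if v: "v \<in> V" for v
  proof -
    obtain p where p: "is_path ?E p a v" and u: "\<And>q. is_path ?E q a v \<Longrightarrow> q = p"
      using leaf1[OF v] by (elim ex1E) blast
    show ?thesis
    proof (rule ex1I)
      show "is_path ?E (rev p) v a" by (rule is_path_rev[OF p])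
      show "q = rev p" if "is_path ?E q v a" for q
        using u[OF is_path_rev[OF that]] by auto
    qed
  qed
  have new: "\<exists>!p. is_path ?E p u v" if uv: "u \<in> insert a V" "v \<in> insert a V" for u v
  proof -
    consider "u = a" "v = a" | "u = a" "v \<in> V" | "u \<in> V" "v = a" | "u \<in> V" "v \<in> V"
      using uv by blast
    then show ?thesis
    proof cases
      case 1
      then show ?thesis by (simp add: is_path_same)
    next
      case 2
      show ?thesis unfolding 2(1) by (rule leaf1[OF 2(2)])
    next
      case 3
      show ?thesis unfolding 3(2) by (rule leaf2[OF 3(1)])
    next
      case 4
      show ?thesis unfolding old[OF 4] by (rule uniq[OF 4])
    qed
  qed
  have new_edges: "e \<subseteq> insert a V \<and> card e = 2" if "e \<in> ?E" for e
  proof (cases "e = {a, b}")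
    case True
    then show ?thesis using assms by (cases "a = b") auto
  next
    case False
    then show ?thesis using that edges[of e] by auto
  qed
  show ?thesis
    unfolding is_tree_def
  proof (intro conjI ballI)
    show "\<exists>!p. is_path ?E p u v" if "u \<in> insert a V" "v \<in> insert a V" for u v
      by (rule new[OF that])
  next
    show "e \<subseteq> insert a V" "card e = 2" if "e \<in> ?E" for e
      using new_edges[OF that] by simp_all
  qed simp
qed

definition parent_edges :: "nat \<Rightarrow> (nat \<Rightarrow> nat) \<Rightarrow> nat set set" where
  "parent_edges n f = (\<lambda>j. {j, f j}) ` {1..n}"

lemma is_tree_parent_edges:
  assumes "parents_smaller n f"
  shows "is_tree {0..n} (parent_edges n f)"
  using assms
proof (induction n)
  case 0
  then show ?case by (auto simp: is_tree_def parent_edges_def is_path_same)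
next
  case (Suc n)
  have "f (Suc n) < Suc n" by (rule parents_smallerD[OF Suc.prems]) simp_all
  moreover have "parents_smaller n f" using Suc.prems by (simp add: parents_smaller_def)
  ultimately have "is_tree (insert (Suc n) {0..n}) (insert {Suc n, f (Suc n)} (parent_edges n f))"
    by (intro is_tree_add_leaf Suc.IH) simp_all
  moreover have "parent_edges (Suc n) f = insert {Suc n, f (Suc n)} (parent_edges n f)"
    by (simp add: parent_edges_def atLeastAtMostSuc_conv)
  ultimately show ?case by (simp add: atLeastAtMostSuc_conv)
qed

lemma path_to_root_eqI:
  assumes "is_tree {0..n} T" "j \<le> n" "is_path T p j 0"
  shows "path_to_root T j = p"
proof -
  have "\<exists>!p. is_path T p j 0" using assms by (auto simp: is_tree_def)
  then show ?thesis
    unfolding path_to_root_def using assms(3) by (intro the1_equality)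
qed

lemma is_path_path_to_root:
  assumes "is_tree {0..n} T" "j \<le> n"
  shows "is_path T (path_to_root T j) j 0"
proof -
  have "\<exists>p. is_path T p j 0" using assms unfolding is_tree_def by (meson atLeastAtMost_iff zero_le)
  then show ?thesis using path_to_root_eqI[OF assms] by auto
qed

lemma path_to_root_0: "is_tree {0..n} T \<Longrightarrow> path_to_root T 0 = [0]"
  by (rule path_to_root_eqI[of n]) auto

lemma path_to_root_unfold:
  assumes tree: "is_tree {0..n} T" and "0 < j" "j \<le> n"
  shows "path_to_root T j = j # path_to_root T (par T j)" (is ?eq)
    and "par T j \<le> n" and "{j, par T j} \<in> T" and "j \<notin> set (path_to_root T (par T j))"
proof -
  have "is_path T (path_to_root T j) j 0" using is_path_path_to_root[OF tree assms(3)] .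
  moreover have "j \<noteq> 0" using assms(2) by simp
  ultimately obtain q where q: "path_to_root T j = j # q" "q \<noteq> []" "j \<notin> set q" "{j, hd q} \<in> T"
      "is_path T q (hd q) 0"
    by (rule is_path_Cons_cases)
  have par: "par T j = hd q" using q by (simp add: par_def hd_conv_nth)
  show "par T j \<le> n" "{j, par T j} \<in> T"
    using q(4) tree par by (auto simp: is_tree_def)
  then show ?eq "j \<notin> set (path_to_root T (par T j))"
    using path_to_root_eqI[OF tree, of "hd q" q] q par by auto
qed

text \<open>
  This is how parents are computed below: it suffices to exhibit some path to the root.
\<close>

lemma path_to_root_parent:
  assumes tree: "is_tree {0..n} T" and "j \<le> n" "p \<noteq> []" "is_path T (j # p) j 0"
  shows "par T j = hd p"
  using path_to_root_eqI[OF tree assms(2,4)] assms(3) by (simp add: par_def hd_conv_nth)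

lemma tree_le_root: "is_tree {0..n} T \<Longrightarrow> tree_le T i 0 \<longleftrightarrow> i = 0"
  by (simp add: tree_le_def path_to_root_0)

lemma tree_le_unfold:
  assumes "is_tree {0..n} T" "0 < j" "j \<le> n"
  shows "tree_le T i j \<longleftrightarrow> i = j \<or> tree_le T i (par T j)"
  unfolding tree_le_def by (subst path_to_root_unfold(1)[OF assms]) simp

lemma tree_le_iff_anc:
  assumes tree: "is_tree {0..n} T" and dec: "parents_smaller n (par T)"
  shows "j \<le> n \<Longrightarrow> tree_le T i j \<longleftrightarrow> anc (par T) i j"
proof (induction j rule: less_induct)
  case (less j)
  show ?case
  proof (cases "j = 0")
    case False
    then show ?thesis
      using less parents_smallerD[OF dec, of j] tree_le_unfold[OF tree, of j i] anc_unfold[of "par T" i j]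
      by simp
  qed (simp add: tree_le_root[OF tree])
qed

lemma rooted_plane_treesD:
  assumes "T \<in> rooted_plane_trees n"
  shows "is_tree {0..n} T"
    and "tree_le T i j \<Longrightarrow> 0 < i \<Longrightarrow> i \<le> n \<Longrightarrow> 0 < j \<Longrightarrow> j \<le> n \<Longrightarrow> i \<le> j"
    and "tree_le T i k \<Longrightarrow> 0 < i \<Longrightarrow> i < j \<Longrightarrow> j < k \<Longrightarrow> k \<le> n \<Longrightarrow> tree_le T i j"
proof -
  have T: "is_tree {0..n} T" "\<forall>i\<in>{1..n}. \<forall>j\<in>{1..n}. tree_le T i j \<longrightarrow> i \<le> j"
    "\<forall>i\<in>{1..n}. \<forall>j\<in>{1..n}. \<forall>k\<in>{1..n}. i < j \<and> j < k \<and> tree_le T i k \<longrightarrow> tree_le T i j"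
    using assms unfolding rooted_plane_trees_def by blast+
  show "is_tree {0..n} T" by fact
  show "tree_le T i j \<Longrightarrow> 0 < i \<Longrightarrow> i \<le> n \<Longrightarrow> 0 < j \<Longrightarrow> j \<le> n \<Longrightarrow> i \<le> j"
    by (rule T(2)[rule_format]) simp_all
  show "tree_le T i k \<Longrightarrow> 0 < i \<Longrightarrow> i < j \<Longrightarrow> j < k \<Longrightarrow> k \<le> n \<Longrightarrow> tree_le T i j"
    by (rule T(3)[rule_format, of i j k]) simp_all
qed

lemma parents_smaller_par:
  assumes "T \<in> rooted_plane_trees n"
  shows "parents_smaller n (par T)"
  unfolding parents_smaller_def
proof
  fix j assume j: "j \<in> {1..n}"
  show "par T j < j"
  proof (cases "par T j = 0")
    case False
    note tree = rooted_plane_treesD(1)[OF assms]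
    have "0 < j" "j \<le> n" using j by auto
    note unf = path_to_root_unfold[OF tree this]
    have self: "par T j \<in> set (path_to_root T (par T j))"
      by (rule is_path_ends(4)[OF is_path_path_to_root[OF tree unf(2)]])
    then have "tree_le T (par T j) j"
      unfolding tree_le_def by (subst unf(1)) simp
    then have "par T j \<le> j"
      by (rule rooted_plane_treesD(2)[OF assms]) (use False unf(2) j in auto)
    moreover have "par T j \<noteq> j" using self unf(4) by metis
    ultimately show ?thesis by simp
  qed (use j in simp)
qed

text \<open>
  Of the two ends of an edge, one is the parent of the other: the path to the root from one end
  either avoids the other end, and can then be extended to it, or contains it, and can then be
  shortcut along the edge.
\<close>

lemma tree_eq_parent_edges:
  assumes tree: "is_tree {0..n} T"
  shows "T = parent_edges n (par T)"
proof
  show "parent_edges n (par T) \<subseteq> T"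
    using path_to_root_unfold(3)[OF tree] by (auto simp: parent_edges_def)
  show "T \<subseteq> parent_edges n (par T)"
  proof
    fix e assume "e \<in> T"
    then obtain a b where e: "e = {a, b}" "a \<noteq> b" "a \<le> n" "b \<le> n"
      using tree by (fastforce simp: is_tree_def card_2_iff)
    have edge: "par T a = b \<and> 0 < a \<or> par T b = a \<and> 0 < b"
    proof (cases "b \<in> set (path_to_root T a)")
      case False
      have pa: "is_path T (path_to_root T a) a 0" using is_path_path_to_root[OF tree] e by simp
      then have ne: "path_to_root T a \<noteq> []" "hd (path_to_root T a) = a" "0 \<in> set (path_to_root T a)"
        by (simp_all add: is_path_ends[OF pa])
      then have "is_path T (b # path_to_root T a) b 0"
        using False e \<open>e \<in> T\<close> pa by (simp add: is_path_Cons insert_commute)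
      then have "par T b = a"
        using path_to_root_parent[OF tree] e ne by metis
      moreover have "0 < b" using ne False by (auto intro: Nat.gr0I)
      ultimately show ?thesis by simp
    next
      case True
      have pa: "is_path T (path_to_root T a) a 0" using is_path_path_to_root[OF tree] e by simp
      have "a \<noteq> 0"
      proof
        assume "a = 0"
        then show False using True e(2) by (simp add: path_to_root_0[OF tree])
      qed
      with pa obtain q where q: "path_to_root T a = a # q" "a \<notin> set q" "q \<noteq> []" "is_path T q (hd q) 0"
        by (rule is_path_Cons_cases)
      then have "b \<in> set q" using True e by simp
      then obtain ys zs where qz: "q = ys @ b # zs" by (auto simp: in_set_conv_decomp)
      have "is_path T (b # zs) b 0"
        unfolding is_path_def
      proof (intro conjI allI impI)
        fix i assume i: "Suc i < length (b # zs)"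
        have "Suc (length ys + i) < length q" using i qz by simp
        then have "{q ! (length ys + i), q ! (length ys + Suc i)} \<in> T"
          using q(4) unfolding is_path_def by simp
        then show "{(b # zs) ! i, (b # zs) ! Suc i} \<in> T"
          unfolding qz nth_append_length_plus .
      qed (use q(4) qz in \<open>auto simp: is_path_def\<close>)
      then have "is_path T (a # b # zs) a 0"
        using q(2) qz \<open>e \<in> T\<close> e by (simp add: is_path_Cons)
      then have "par T a = b"
        using path_to_root_parent[OF tree, of a "b # zs"] e by simp
      with \<open>a \<noteq> 0\<close> show ?thesis by simp
    qed
    show "e \<in> parent_edges n (par T)"
      using edge
    proof
      assume "par T a = b \<and> 0 < a"
      then have "a \<in> {1..n}" "e = {a, par T a}" using e by auto
      then show ?thesis unfolding parent_edges_def by blast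
    next
      assume "par T b = a \<and> 0 < b"
      then have "b \<in> {1..n}" "e = {b, par T b}" using e by auto
      then show ?thesis unfolding parent_edges_def by blast
    qed
  qed
qed

lemma par_parent_edges:
  assumes dec: "parents_smaller n f"
    and "0 < j" "j \<le> n"
  shows "par (parent_edges n f) j = f j"
proof -
  let ?T = "parent_edges n f"
  have tree: "is_tree {0..n} ?T" by (rule is_tree_parent_edges[OF dec])
  have extend: "is_path ?T (k # p) k 0"
    if "0 < k" "k \<le> n" "is_path ?T p (f k) 0" "\<forall>u\<in>set p. u \<le> f k" for k p
  proof -
    have "{k, f k} \<in> ?T" using that by (auto simp: parent_edges_def)
    moreover have "k \<notin> set p" using that parents_smallerD[OF dec, of k] by auto
    moreover have "p \<noteq> []" "hd p = f k" using that(3) by (auto simp: is_path_def)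
    ultimately show ?thesis using that(3) by (simp add: is_path_Cons)
  qed
  have ex: "k \<le> n \<Longrightarrow> \<exists>p. is_path ?T p k 0 \<and> (\<forall>u\<in>set p. u \<le> k)" for k
  proof (induction k rule: less_induct)
    case (less k)
    show ?case
    proof (cases "k = 0")
      case True
      then show ?thesis by (intro exI[of _ "[0]"]) simp
    next
      case False
      then have k: "0 < k" "f k < k" using parents_smallerD[OF dec, of k] less.prems by auto
      then obtain p where p: "is_path ?T p (f k) 0" "\<forall>u\<in>set p. u \<le> f k"
        using less.IH[of "f k"] less.prems by auto
      have "is_path ?T (k # p) k 0" by (rule extend[OF k(1) less.prems p])
      moreover have "\<forall>u\<in>set (k # p). u \<le> k" using p(2) k by auto
      ultimately show ?thesis by blast
    qed
  qed
  obtain p where p: "is_path ?T p (f j) 0" "\<forall>u\<in>set p. u \<le> f j"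
    using ex[of "f j"] parents_smallerD[OF dec, of j] assms by auto
  have "p \<noteq> []" "hd p = f j" using p by (auto simp: is_path_def)
  then show ?thesis
    using path_to_root_parent[OF tree _ _ extend[OF _ _ p]] assms by simp
qed

lemma plane_parent_par:
  assumes T: "T \<in> rooted_plane_trees n"
  shows "plane_parent n (par T)"
  unfolding plane_parent_def
proof (intro allI impI)
  fix m assume m: "m < n"
  note tree = rooted_plane_treesD(1)[OF T]
  note dec = parents_smaller_par[OF T]
  note le = tree_le_iff_anc[OF tree dec]
  let ?u = "par T (Suc m)"
  have u: "?u \<le> m" using parents_smallerD[OF dec, of "Suc m"] m by simp
  have "anc (par T) ?u (Suc m)" by (intro anc.intros) simp
  then have "tree_le T ?u (Suc m)" using le[of "Suc m" ?u] m by simp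
  then have "tree_le T ?u m" if "0 < ?u" "?u < m"
    using rooted_plane_treesD(3)[OF T, of ?u "Suc m" m] that m by simp
  then show "anc (par T) ?u m"
    using u m le[of m ?u] anc_root[OF dec, of m] anc_refl[of "par T" m]
    by (cases "?u = 0"; cases "?u = m") auto
qed

lemma parent_edges_rooted_plane_tree:
  assumes f: "plane_parent n f"
  shows "parent_edges n f \<in> rooted_plane_trees n"
proof -
  note dec = plane_parent_parents_smaller[OF f]
  note tree = is_tree_parent_edges[OF dec]
  note par = par_parent_edges[OF dec]
  have dec': "parents_smaller n (par (parent_edges n f))"
    using dec par by (simp add: parents_smaller_def)
  have "tree_le (parent_edges n f) i j \<longleftrightarrow> anc f i j" if "j \<le> n" for i j
    using tree_le_iff_anc[OF tree dec', of j i] anc_cong[OF dec, of "par (parent_edges n f)" j i]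
      anc_cong[OF dec, of "par (parent_edges n f)"] that par by simp
  note le = this
  show ?thesis
    unfolding rooted_plane_trees_def
  proof (intro CollectI conjI ballI impI)
    show "i \<le> j" if "j \<in> {1..n}" "tree_le (parent_edges n f) i j" for i j
      using that le[of j i] anc_le[OF dec, of i j] by simp
    show "tree_le (parent_edges n f) i j"
      if "j \<in> {1..n}" "k \<in> {1..n}" "i < j \<and> j < k \<and> tree_le (parent_edges n f) i k" for i j k
      using that le[of j i] le[of k i] plane_parent_convex[OF f, of k i j] by simp
  qed (rule tree)
qed

section \<open>The next vertex of the search\<close>

lemma threshold_crossing:
  fixes a K :: nat and wt :: "nat \<Rightarrow> nat"
  assumes "finite R" "a < K" "K \<le> a + sum wt R"
  obtains w where "w \<in> R" "a + sum wt {u\<in>R. u < w} < K" "K \<le> a + sum wt {u\<in>R. u \<le> w}"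
proof -
  let ?W = "{w\<in>R. K \<le> a + sum wt {u\<in>R. u \<le> w}}"
  have "R \<noteq> {}" using assms by auto
  then have "Max R \<in> R" "{u\<in>R. u \<le> Max R} = R" using assms(1) by auto
  then have "Max R \<in> ?W" using assms(3) by simp
  then have W: "finite ?W" "?W \<noteq> {}" using assms(1) by auto
  define w where "w = Min ?W"
  have w: "w \<in> ?W" unfolding w_def using W by (rule Min_in)
  have "a + sum wt {u\<in>R. u < w} < K"
  proof (cases "{u\<in>R. u < w} = {}")
    case True
    then show ?thesis using assms(2) by (simp only: sum.empty)
  next
    case False
    define p where "p = Max {u\<in>R. u < w}"
    have p: "p \<in> {u\<in>R. u < w}"
      unfolding p_def using False assms(1) by (intro Max_in) auto
    have "u \<le> p" if "u \<in> R" "u < w" for u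
      unfolding p_def using that assms(1) by (intro Max_ge) auto
    with p have eq: "{u\<in>R. u \<le> p} = {u\<in>R. u < w}" by force
    have "p \<notin> ?W"
    proof
      assume "p \<in> ?W"
      then have "w \<le> p" unfolding w_def using W(1) by (rule Min_le[rotated])
      with p show False by simp
    qed
    then show ?thesis using p eq by simp
  qed
  with w that show thesis by blast
qed

text \<open>
  One step of the search, stripped of the tree. The unvisited labels are \<open>C\<close>, the counter of the
  label \<open>c\<close> is \<open>a c\<close>, and \<open>K\<close> is the total weight of all visited vertices. The set \<open>R c\<close> consists
  of the visited vertices that have not yet examined \<open>c\<close>; larger vertices are deeper and examine
  first. By the time that \<open>w\<close> examines \<open>c\<close>, exactly \<open>w\<close> and the smaller vertices of
  \<open>R c\<close> have not yet done so. Hence the two inequalities say that the weights subtracted from \<open>a c\<close> so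
  far do not exceed it, while subtracting also the weight of \<open>w\<close> would. The last condition says
  that every other label has survived all examinations that precede the one of \<open>c\<close> by \<open>w\<close>.
\<close>

definition captures :: "(nat \<Rightarrow> nat) \<Rightarrow> (nat \<Rightarrow> nat) \<Rightarrow> nat \<Rightarrow> (nat \<Rightarrow> nat set) \<Rightarrow> nat set \<Rightarrow> nat \<Rightarrow> nat \<Rightarrow> bool"
  where
  "captures wt a K R C w c \<longleftrightarrow> c \<in> C \<and> w \<in> R c \<and>
     a c + sum wt {u\<in>R c. u < w} < K \<and> K \<le> a c + sum wt {u\<in>R c. u \<le> w} \<and>
     (\<forall>d\<in>C - {c}. K \<le> a d + sum wt {u\<in>R d. u < w \<or> u = w \<and> d < c})"

text \<open>
  Every label whose counter is below \<open>K\<close> would be caught at some vertex, where its counter is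
  exhausted. The first capture in time is the one at the deepest vertex and, there, of the largest
  label, that is, the lexicographically largest pair.
\<close>

lemma captures_exists:
  assumes fin: "finite C" "\<And>c. c \<in> C \<Longrightarrow> finite (R c)"
    and slack: "\<And>c. c \<in> C \<Longrightarrow> K \<le> a c + sum wt (R c)"
    and "c\<^sub>0 \<in> C" "a c\<^sub>0 < K"
  shows "\<exists>w c. captures wt a K R C w c"
proof -
  define crosses where "crosses w c \<longleftrightarrow> c \<in> C \<and> w \<in> R c \<and>
     a c + sum wt {u\<in>R c. u < w} < K \<and> K \<le> a c + sum wt {u\<in>R c. u \<le> w}" for w c
  have crosses_ex: "\<exists>w. crosses w c" if c: "c \<in> C" "a c < K" for c
  proof -
    obtain w where "w \<in> R c" "a c + sum wt {u\<in>R c. u < w} < K" "K \<le> a c + sum wt {u\<in>R c. u \<le> w}"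
      using threshold_crossing[OF fin(2)[OF c(1)] c(2) slack[OF c(1)]] .
    then show ?thesis using c(1) unfolding crosses_def by blast
  qed
  let ?W = "{w. \<exists>c. crosses w c}"
  have "?W \<subseteq> (\<Union>c\<in>C. R c)" unfolding crosses_def by blast
  then have finW: "finite ?W" by (rule finite_subset) (use fin in blast)
  have "?W \<noteq> {}" using crosses_ex[OF assms(4,5)] by blast
  define w where "w = Max ?W"
  have "w \<in> ?W" unfolding w_def by (rule Max_in) fact+
  then have neC: "{c. crosses w c} \<noteq> {}" by blast
  have finC: "finite {c. crosses w c}"
    by (rule finite_subset[OF _ fin(1)]) (auto simp: crosses_def)
  define c where "c = Max {c. crosses w c}"
  have "c \<in> {c. crosses w c}" unfolding c_def by (rule Max_in[OF finC neC])
  then have c: "crosses w c" by simp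
  have "K \<le> a d + sum wt {u\<in>R d. u < w \<or> u = w \<and> d < c}" if d: "d \<in> C - {c}" for d
  proof (cases "a d < K")
    case True
    with d obtain w' where w': "crosses w' d" using crosses_ex by blast
    then have "w' \<le> w" unfolding w_def using finW by (intro Max_ge) auto
    moreover have "d < c" if "w' = w"
    proof -
      have "d \<le> c" using w' that finC unfolding c_def by (intro Max_ge) auto
      with d show ?thesis by simp
    qed
    ultimately have "{u\<in>R d. u \<le> w'} \<subseteq> {u\<in>R d. u < w \<or> u = w \<and> d < c}" by auto
    then have "sum wt {u\<in>R d. u \<le> w'} \<le> sum wt {u\<in>R d. u < w \<or> u = w \<and> d < c}"
      using fin(2) d by (intro sum_mono2) auto
    with w' show ?thesis unfolding crosses_def by linarith
  qed simp
  with c show ?thesis unfolding crosses_def captures_def by blast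
qed

text \<open>
  If two captures were possible, then the label of the later one would already be exhausted at an
  examination that the earlier one requires it to survive.
\<close>

lemma captures_unique:
  assumes fin: "\<And>c. c \<in> C \<Longrightarrow> finite (R c)"
    and 1: "captures wt a K R C w c" and 2: "captures wt a K R C w' c'"
  shows "w = w' \<and> c = c'"
proof -
  have later: False
    if "captures wt a K R C w c" "captures wt a K R C w' c'" "w < w' \<or> w = w' \<and> c < c'"
    for w c w' c'
  proof -
    have "{u\<in>R c'. u < w \<or> u = w \<and> c' < c} \<subseteq> {u\<in>R c'. u < w'}"
      "c = c' \<Longrightarrow> {u\<in>R c'. u \<le> w} \<subseteq> {u\<in>R c'. u < w'}"
      using that(3) by auto
    then have "sum wt {u\<in>R c'. u < w \<or> u = w \<and> c' < c} \<le> sum wt {u\<in>R c'. u < w'}"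
      "c = c' \<Longrightarrow> sum wt {u\<in>R c'. u \<le> w} \<le> sum wt {u\<in>R c'. u < w'}"
      using fin[of c'] that(2) by (auto simp: captures_def intro!: sum_mono2)
    moreover have "a c' + sum wt {u\<in>R c'. u < w'} < K"
      "c = c' \<Longrightarrow> K \<le> a c' + sum wt {u\<in>R c'. u \<le> w}"
      "c \<noteq> c' \<Longrightarrow> K \<le> a c' + sum wt {u\<in>R c'. u < w \<or> u = w \<and> c' < c}"
      using that(1,2) by (auto simp: captures_def)
    ultimately show False by (cases "c = c'") auto
  qed
  show ?thesis
    using later[OF 1 2] later[OF 2 1]
    by (cases w w' rule: linorder_cases; cases c c' rule: linorder_cases) auto
qed

section \<open>The depth-first burning process\<close>

text \<open>
  Vertices are numbered in the order of their visit, \<open>f\<close> gives their parents and \<open>v\<close> their labels.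
  The set \<open>pending f v c m\<close> consists of the vertices that have not yet examined the label \<open>c\<close> when
  \<open>m\<close> has just been visited. When the vertex \<open>Suc m\<close> is found from \<open>f (Suc m)\<close>, all deeper vertices
  have examined everything, and \<open>f (Suc m)\<close> itself has examined all labels down to \<open>v (Suc m)\<close>.
\<close>

primrec pending :: "(nat \<Rightarrow> nat) \<Rightarrow> (nat \<Rightarrow> nat) \<Rightarrow> nat \<Rightarrow> nat \<Rightarrow> nat set" where
  "pending f v c 0 = {0}"
| "pending f v c (Suc m) = insert (Suc m)
     {u\<in>pending f v c m. u < f (Suc m) \<or> u = f (Suc m) \<and> c < v (Suc m)}"

lemma pending_subset: "pending f v c m \<subseteq> {..m}"
  by (induction m) auto

lemma finite_pending [simp]: "finite (pending f v c m)"
  by (rule finite_subset[OF pending_subset]) simp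

lemma pending_cong:
  "(\<And>j. 0 < j \<Longrightarrow> j \<le> m \<Longrightarrow> f j = f' j \<and> v j = v' j) \<Longrightarrow> pending f v c m = pending f' v' c m"
  by (induction m) auto

definition unvisited :: "nat \<Rightarrow> (nat \<Rightarrow> nat) \<Rightarrow> nat \<Rightarrow> nat set" where
  "unvisited n v m = {..<n} - v ` {1..m}"

lemma unvisited_Suc: "unvisited n v (Suc m) = unvisited n v m - {v (Suc m)}"
  by (auto simp: unvisited_def atLeastAtMostSuc_conv)

text \<open>
  Whether vertex \<open>Suc m\<close> is caught by its parent, as in the definition of \<open>captures\<close>. Here and
  below, \<open>wt u\<close> is the weight that the vertex \<open>u\<close> subtracts from a counter.
\<close>

definition burns_to ::
    "(nat \<Rightarrow> nat) \<Rightarrow> (nat \<Rightarrow> nat) \<Rightarrow> (nat \<Rightarrow> nat) \<Rightarrow> (nat \<Rightarrow> nat) \<Rightarrow> nat \<Rightarrow> bool" where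
  "burns_to wt a f v m \<longleftrightarrow>
     (let w = f (Suc m); c = v (Suc m); R = pending f v c m in
       a c + sum wt {u\<in>R. u < w} < sum wt {..m} \<and> sum wt {..m} \<le> a c + sum wt {u\<in>R. u \<le> w})"

text \<open>
  The condition on the labels that are still unvisited says that they have survived all examinations
  up to now.
\<close>

definition burning ::
    "nat \<Rightarrow> (nat \<Rightarrow> nat) \<Rightarrow> (nat \<Rightarrow> nat) \<Rightarrow> (nat \<Rightarrow> nat) \<Rightarrow> (nat \<Rightarrow> nat) \<Rightarrow> nat \<Rightarrow> bool" where
  "burning n wt a f v m \<longleftrightarrow>
     (\<forall>k<m. v (Suc k) \<in> unvisited n v k \<and> f (Suc k) \<in> pending f v (v (Suc k)) k \<and>
        burns_to wt a f v k) \<and>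
     (\<forall>c\<in>unvisited n v m. sum wt {..m} \<le> a c + sum wt (pending f v c m))"

text \<open>
  The labels that survive up to time \<open>Suc m\<close>, and the one that is caught then, have survived up to
  time \<open>m\<close>. So the requirements on a run can be checked one step at a time.
\<close>

lemma burning_Suc:
  "burning n wt a f v (Suc m) \<longleftrightarrow> burning n wt a f v m \<and>
     captures wt a (sum wt {..m}) (\<lambda>c. pending f v c m) (unvisited n v m) (f (Suc m)) (v (Suc m))"
proof -
  let ?K = "sum wt {..m}" and ?R = "\<lambda>c. pending f v c m"
  let ?low = "\<lambda>c. {u\<in>?R c. u < f (Suc m) \<or> u = f (Suc m) \<and> c < v (Suc m)}"
  have pend: "sum wt {..Suc m} \<le> a c + sum wt (pending f v c (Suc m)) \<longleftrightarrow> ?K \<le> a c + sum wt (?low c)" for c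
  proof -
    have "Suc m \<notin> ?low c" using pending_subset[of f v c m] by auto
    then show ?thesis by simp
  qed
  have mono: "sum wt (?low c) \<le> sum wt (?R c)" "sum wt {u\<in>?R c. u \<le> f (Suc m)} \<le> sum wt (?R c)" for c
    by (rule sum_mono2; auto)+
  have slack: "?K \<le> a c + sum wt (?R c)"
    if "c \<in> unvisited n v m" "burns_to wt a f v m"
      "\<forall>c\<in>unvisited n v m - {v (Suc m)}. ?K \<le> a c + sum wt (?low c)" for c
  proof (cases "c = v (Suc m)")
    case True
    then have "?K \<le> a c + sum wt {u\<in>?R c. u \<le> f (Suc m)}"
      using that(2) by (simp add: burns_to_def Let_def)
    then show ?thesis using mono(2)[of c] by linarith
  next
    case False
    then show ?thesis using that(1,3) mono(1)[of c] by force
  qed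
  have iff: "burning n wt a f v (Suc m) \<longleftrightarrow>
     (\<forall>k<m. v (Suc k) \<in> unvisited n v k \<and> f (Suc k) \<in> pending f v (v (Suc k)) k \<and>
        burns_to wt a f v k) \<and>
     captures wt a ?K ?R (unvisited n v m) (f (Suc m)) (v (Suc m))"
    unfolding burning_def captures_def unvisited_Suc pend
    by (simp only: All_less_Suc burns_to_def[of _ _ _ _ m] Let_def conj_ac)
  have imp: "\<forall>c\<in>unvisited n v m. ?K \<le> a c + sum wt (?R c)"
    if "captures wt a ?K ?R (unvisited n v m) (f (Suc m)) (v (Suc m))"
  proof
    fix c assume "c \<in> unvisited n v m"
    then show "?K \<le> a c + sum wt (?R c)"
      by (rule slack) (use that in \<open>simp_all add: captures_def burns_to_def Let_def\<close>)
  qed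
  have absorb: "P \<and> C \<longleftrightarrow> (P \<and> Q) \<and> C" if "C \<Longrightarrow> Q" for P Q C
    using that by blast
  show ?thesis unfolding iff unfolding burning_def by (rule absorb, rule imp)
qed

lemma burning_unique:
  assumes "burning n wt a f v m" "burning n wt a f' v' m"
  shows "0 < j \<Longrightarrow> j \<le> m \<Longrightarrow> f j = f' j \<and> v j = v' j"
  using assms
proof (induction m arbitrary: j)
  case (Suc m)
  have eq: "f j = f' j \<and> v j = v' j" if "0 < j" "j \<le> m" for j
    using Suc.IH[OF that] Suc.prems(3,4) by (simp add: burning_Suc)
  have pend: "pending f' v' c m = pending f v c m" for c
    by (rule pending_cong[OF eq, symmetric])
  have "v ` {1..m} = v' ` {1..m}"
    by (rule image_cong) (simp_all add: eq)
  then have unv: "unvisited n v' m = unvisited n v m"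
    by (simp add: unvisited_def)
  let ?cap = "captures wt a (sum wt {..m}) (\<lambda>c. pending f v c m) (unvisited n v m)"
  have 1: "?cap (f (Suc m)) (v (Suc m))"
    using Suc.prems(3) by (simp only: burning_Suc)
  have 2: "?cap (f' (Suc m)) (v' (Suc m))"
    using Suc.prems(4) by (simp only: burning_Suc pend unv)
  have "f (Suc m) = f' (Suc m) \<and> v (Suc m) = v' (Suc m)"
    by (rule captures_unique[OF _ 1 2]) simp
  with eq[of j] Suc.prems(1,2) show ?case by (cases "j = Suc m") simp_all
qed simp

lemma burning_cong:
  assumes "\<And>j. 0 < j \<Longrightarrow> j \<le> m \<Longrightarrow> f j = f' j \<and> v j = v' j"
  shows "burning n wt a f v m \<longleftrightarrow> burning n wt a f' v' m"
proof -
  have pend: "pending f v c k = pending f' v' c k" if "k \<le> m" for c k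
    by (rule pending_cong, rule assms) (use that in simp_all)
  have unv: "unvisited n v k = unvisited n v' k" if "k \<le> m" for k
  proof -
    have "v ` {1..k} = v' ` {1..k}"
      using that by (intro image_cong) (simp_all add: assms)
    then show ?thesis by (simp add: unvisited_def)
  qed
  show ?thesis
    unfolding burning_def burns_to_def Let_def
    by (intro conj_cong all_cong ball_cong) (simp_all add: pend unv assms)
qed

text \<open>
  The assumption lets the search go on: more than \<open>m\<close> labels have a counter below the total weight
  of the vertices \<open>0, ..., m\<close>, and only \<open>m\<close> labels have been visited.
\<close>

lemma burning_exists:
  assumes "\<And>m. m < n \<Longrightarrow> m < card {c\<in>{..<n}. a c < sum wt {..m}}"
  shows "m \<le> n \<Longrightarrow> \<exists>f v. burning n wt a f v m"
proof (induction m)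
  case 0
  show ?case by (simp add: burning_def)
next
  case (Suc m)
  then obtain f v where fv: "burning n wt a f v m" by auto
  have "card (v ` {1..m}) \<le> m" using card_image_le[of "{1..m}" v] by simp
  also have "m < card {c\<in>{..<n}. a c < sum wt {..m}}" using assms Suc.prems by simp
  finally have less: "card (v ` {1..m}) < card {c\<in>{..<n}. a c < sum wt {..m}}" .
  have "\<not> {c\<in>{..<n}. a c < sum wt {..m}} \<subseteq> v ` {1..m}"
  proof
    assume "{c\<in>{..<n}. a c < sum wt {..m}} \<subseteq> v ` {1..m}"
    from card_mono[OF _ this] less show False by simp
  qed
  then obtain c\<^sub>0 where "c\<^sub>0 \<in> unvisited n v m" "a c\<^sub>0 < sum wt {..m}"
    by (auto simp: unvisited_def)
  moreover have "finite (unvisited n v m)" by (simp add: unvisited_def)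
  moreover have "\<And>c. c \<in> unvisited n v m \<Longrightarrow> sum wt {..m} \<le> a c + sum wt (pending f v c m)"
    using fv by (simp add: burning_def)
  ultimately have "\<exists>w c. captures wt a (sum wt {..m}) (\<lambda>c. pending f v c m) (unvisited n v m) w c"
    by (intro captures_exists) simp_all
  then obtain w c where wc:
    "captures wt a (sum wt {..m}) (\<lambda>c. pending f v c m) (unvisited n v m) w c"
    by blast
  let ?f = "f(Suc m := w)" and ?v = "v(Suc m := c)"
  have "burning n wt a ?f ?v m" using fv by (subst burning_cong[of m _ f _ v]) auto
  moreover have "pending ?f ?v d m = pending f v d m" for d by (rule pending_cong) simp
  moreover have "unvisited n ?v m = unvisited n v m" by (auto simp: unvisited_def)
  ultimately have "burning n wt a ?f ?v (Suc m)" using wc by (simp add: burning_Suc)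
  then show ?case by blast
qed

section \<open>Runs of the search are plane trees with an admissible order\<close>

text \<open>
  The new label is one that its parent has not yet examined. This says two things at once: the
  parent lies on the path from the current vertex to the root, and labels of siblings decrease.
\<close>

definition dfs_run :: "nat \<Rightarrow> (nat \<Rightarrow> nat) \<Rightarrow> (nat \<Rightarrow> nat) \<Rightarrow> bool" where
  "dfs_run n f v \<longleftrightarrow> (\<forall>k<n. f (Suc k) \<in> pending f v (v (Suc k)) k)"

lemma dfs_run_parents_smaller: "dfs_run n f v \<Longrightarrow> parents_smaller n f"
  unfolding parents_smaller_def
proof
  fix j assume run: "dfs_run n f v" and j: "j \<in> {1..n}"
  then obtain k where k: "j = Suc k" "k < n" by (cases j) auto
  then have "f j \<in> {..k}" using run pending_subset unfolding dfs_run_def by blast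
  then show "f j < j" using k by simp
qed

text \<open>
  A vertex on the path from \<open>m\<close> to the root, other than \<open>m\<close>, is the parent of the next vertex \<open>i\<close> on
  this path. Labels are examined in decreasing order and the search went down to \<open>i\<close>, hence the
  labels not yet examined are those below \<open>v i\<close>.
\<close>

lemma pending_eq:
  assumes "dfs_run m f v"
  shows "pending f v c m = insert m (f ` {i. 0 < i \<and> anc f i m \<and> c < v i})"
  using assms
proof (induction m arbitrary: c)
  case (Suc m)
  define w where "w = f (Suc m)"
  have run: "dfs_run m f v" using Suc.prems by (simp add: dfs_run_def)
  have w: "w \<in> pending f v (v (Suc m)) m" using Suc.prems by (simp add: dfs_run_def w_def)
  note IH = Suc.IH[OF run]
  note dec = dfs_run_parents_smaller[OF run]
  have "w \<le> m" using w pending_subset by blast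
  have anc_w: "anc f w m"
  proof (cases "w = m")
    case False
    then obtain i where "w = f i" "0 < i" "anc f i m" using w unfolding IH by blast
    then show ?thesis using anc_trans[of f i m w] anc.anc_parent[of i f w] anc_refl by simp
  qed (simp add: anc_refl)
  have "{u\<in>pending f v c m. u < w \<or> u = w \<and> c < v (Suc m)} =
      f ` {i. 0 < i \<and> anc f i (Suc m) \<and> c < v i}" (is "?L = ?R")
  proof
    show "?L \<subseteq> ?R"
    proof
      fix u assume u: "u \<in> ?L"
      show "u \<in> ?R"
      proof (cases "u = w")
        case True
        then have "c < v (Suc m)" using u by simp
        then show ?thesis using True anc_refl[of f "Suc m"] unfolding w_def by blast
      next
        case False
        then have "u < w" "u \<in> pending f v c m" using u by auto
        then obtain i where i: "u = f i" "0 < i" "anc f i m" "c < v i"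
          using \<open>w \<le> m\<close> unfolding IH by auto
        then have "anc f i w"
          using anc_parent_less_imp[OF dec order_refl i(3,2) anc_w] \<open>u < w\<close> by simp
        then have "anc f i (Suc m)" unfolding w_def by (rule anc.anc_parent[rotated]) simp
        then show ?thesis using i by blast
      qed
    qed
    show "?R \<subseteq> ?L"
    proof
      fix u assume "u \<in> ?R"
      then obtain i where i: "u = f i" "0 < i" "anc f i (Suc m)" "c < v i" by blast
      show "u \<in> ?L"
      proof (cases "i = Suc m")
        case True
        then have "u = w" "c < v (Suc m)" using i by (simp_all add: w_def)
        moreover have "w \<in> pending f v c m"
          using w \<open>c < v (Suc m)\<close> unfolding IH by auto
        ultimately show ?thesis by simp
      next
        case False
        then have "anc f i w" using i(3) unfolding w_def by (subst (asm) anc_unfold) simp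
        then have "i \<le> w" "anc f i m"
          using anc_le[OF dec, of i w] anc_trans[OF anc_w] \<open>w \<le> m\<close> by auto
        then have "u < w" using parents_smallerD[OF dec, of i] i \<open>w \<le> m\<close> by simp
        moreover have "u \<in> pending f v c m" unfolding IH using i \<open>anc f i m\<close> by blast
        ultimately show ?thesis by simp
      qed
    qed
  qed
  then show ?case by (simp add: w_def)
qed auto

text \<open>
  For siblings \<open>i < j\<close>, the run condition at \<open>j\<close> compares \<open>v j\<close> only with the label of the last sibling
  before \<open>j\<close>, the one on the path from \<open>j - 1\<close> to the root; induction over the siblings does the rest.
\<close>

lemma dfs_run_iff:
  "dfs_run n f v \<longleftrightarrow> plane_parent n f \<and>
     (\<forall>i j. 0 < i \<longrightarrow> i < j \<longrightarrow> j \<le> n \<longrightarrow> f i = f j \<longrightarrow> v j < v i)"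
proof (intro iffI conjI allI impI)
  assume run: "dfs_run n f v"
  have run': "dfs_run k f v" if "k \<le> n" for k using run that by (simp add: dfs_run_def)
  have mem: "f (Suc k) = k \<or> (\<exists>i. f (Suc k) = f i \<and> 0 < i \<and> anc f i k \<and> v (Suc k) < v i)"
    if "k < n" for k
  proof -
    have "f (Suc k) \<in> pending f v (v (Suc k)) k"
      using run that by (simp add: dfs_run_def)
    then show ?thesis
      unfolding pending_eq[OF run'[OF less_imp_le[OF that]]] by blast
  qed
  note dec = dfs_run_parents_smaller[OF run]
  show plane: "plane_parent n f"
    unfolding plane_parent_def
  proof (intro allI impI)
    fix k assume "k < n"
    from mem[OF this] show "anc f (f (Suc k)) k"
    proof
      assume "\<exists>i. f (Suc k) = f i \<and> 0 < i \<and> anc f i k \<and> v (Suc k) < v i"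
      then obtain i where "f (Suc k) = f i" "0 < i" "anc f i k" by blast
      then show ?thesis using anc_trans[of f i k "f i"] anc.anc_parent[OF _ anc_refl, of i f] by simp
    qed (simp add: anc_refl)
  qed
  have "\<forall>i. 0 < i \<longrightarrow> i < j \<longrightarrow> j \<le> n \<longrightarrow> f i = f j \<longrightarrow> v j < v i" for j
  proof (induction j rule: less_induct)
    case (less j)
    show ?case
    proof (intro allI impI)
      fix i assume i: "0 < i" "i < j" "j \<le> n" "f i = f j"
      then obtain k where k: "j = Suc k" "k < n" by (cases j) auto
      have "f i < i" using parents_smallerD[OF dec, of i] i by simp
      then have "f j \<noteq> k" using i k by simp
      then obtain i' where i': "f j = f i'" "0 < i'" "anc f i' k" "v j < v i'"
        using mem[OF k(2)] k by auto
      have "i' \<le> k" using anc_le[OF dec i'(3)] k by simp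
      have "i \<le> i'"
      proof (rule ccontr)
        assume "\<not> i \<le> i'"
        then have "anc f i' i" "i' \<noteq> i"
          using plane_parent_convex[OF plane, of k i' i] i' i k by auto
        then have "anc f i' (f i)" by (metis anc_unfold)
        then have "i' \<le> f i" using anc_le[OF dec, of i' "f i"] \<open>f i < i\<close> i by simp
        moreover have "f i' < i'" using parents_smallerD[OF dec, of i'] i' \<open>i' \<le> k\<close> k by simp
        ultimately show False using i i' by simp
      qed
      have "v i' < v i" if "i \<noteq> i'"
        using less.IH[of i'] that \<open>i \<le> i'\<close> i i'(1) \<open>i' \<le> k\<close> k by simp
      then show "v j < v i" using i'(4) by (cases "i = i'") auto
    qed
  qed
  then show "v j < v i" if "0 < i" "i < j" "j \<le> n" "f i = f j" for i j
    using that by blast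
next
  assume asm: "plane_parent n f \<and>
     (\<forall>i j. 0 < i \<longrightarrow> i < j \<longrightarrow> j \<le> n \<longrightarrow> f i = f j \<longrightarrow> v j < v i)"
  note dec = plane_parent_parents_smaller[OF conjunct1[OF asm]]
  have "k \<le> n \<Longrightarrow> dfs_run k f v" for k
  proof (induction k)
    case 0
    show ?case by (simp add: dfs_run_def)
  next
    case (Suc k)
    then have run: "dfs_run k f v" by simp
    have anc: "anc f (f (Suc k)) k" using conjunct1[OF asm] Suc.prems unfolding plane_parent_def by simp
    have "f (Suc k) \<in> pending f v (v (Suc k)) k"
    proof (cases "f (Suc k) = k")
      case True
      then show ?thesis unfolding pending_eq[OF run] by simp
    next
      case False
      then obtain i where i: "0 < i" "anc f i k" "f i = f (Suc k)"
        using anc_toward_child[OF anc] by blast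
      then have "i \<le> k" using anc_le[OF dec, of i k] Suc.prems by simp
      then have "v (Suc k) < v i"
        using conjunct2[OF asm, rule_format, of i "Suc k"] i Suc.prems by simp
      then show ?thesis unfolding pending_eq[OF run] using i by (intro insertI2 image_eqI[of _ _ i]) simp_all
    qed
    then show ?case using run unfolding dfs_run_def All_less_Suc by blast
  qed
  then show "dfs_run n f v" by simp
qed

definition inversions :: "(nat \<Rightarrow> nat) \<Rightarrow> (nat \<Rightarrow> nat) \<Rightarrow> nat \<Rightarrow> nat set" where
  "inversions f v j = {i. 0 < i \<and> anc f i j \<and> v j < v i}"

text \<open>
  The vertices before \<open>j\<close> that never examine the label of \<open>j\<close> are the parents of those proper ancestors
  of \<open>j\<close> whose label is larger. This is the origin of the exponents on the tree side.
\<close>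

lemma sum_pending_below_parent:
  assumes run: "dfs_run (Suc k) f v"
  shows "sum wt {u\<in>pending f v (v (Suc k)) k. u < f (Suc k)} = (\<Sum>i\<in>inversions f v (Suc k). wt (f i))"
proof -
  note dec = dfs_run_parents_smaller[OF run]
  have inv: "inversions f v (Suc k) \<subseteq> {i. 0 < i \<and> anc f i (Suc k)}"
    by (auto simp: inversions_def)
  have "f i < Suc k" if "i \<in> inversions f v (Suc k)" for i
    using that anc_le[OF dec, of i "Suc k"] parents_smallerD[OF dec, of i]
    by (simp add: inversions_def)
  then have notin: "Suc k \<notin> f ` inversions f v (Suc k)" by fastforce
  have "Suc k \<notin> pending f v (v (Suc k)) k" using pending_subset[of f v "v (Suc k)" k] by auto
  moreover have "insert (Suc k) {u\<in>pending f v (v (Suc k)) k. u < f (Suc k)} =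
      insert (Suc k) (f ` inversions f v (Suc k))"
    using pending_eq[OF run, of "v (Suc k)"] by (simp add: inversions_def)
  ultimately have "{u\<in>pending f v (v (Suc k)) k. u < f (Suc k)} = f ` inversions f v (Suc k)"
    using notin by (subst (asm) insert_ident) auto
  moreover have "inj_on f (inversions f v (Suc k))"
    by (rule inj_on_subset[OF parent_inj_on_anc[OF dec order_refl] inv])
  ultimately show ?thesis by (simp add: sum.reindex)
qed

section \<open>Total orders as labellings\<close>

definition rank_in :: "nat rel \<Rightarrow> nat \<Rightarrow> nat" where
  "rank_in r j = card {i. (i, j) \<in> r}"

definition order_of :: "nat \<Rightarrow> (nat \<Rightarrow> nat) \<Rightarrow> nat rel" where
  "order_of n v = {(i, j). i \<in> {1..n} \<and> j \<in> {1..n} \<and> v i < v j}"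

lemma rank_in_less_iff:
  assumes r: "r \<subseteq> {1..n} \<times> {1..n}" "strict_linear_order_on {1..n} r"
    and i: "i \<in> {1..n}" and j: "j \<in> {1..n}"
  shows "rank_in r i < rank_in r j \<longleftrightarrow> (i, j) \<in> r"
proof -
  have less: "rank_in r i < rank_in r j" if "(i, j) \<in> r" for i j
  proof -
    have "{k. (k, j) \<in> r} \<subseteq> {1..n}" using r(1) by blast
    then have "finite {k. (k, j) \<in> r}" by (rule finite_subset) simp
    moreover have "{k. (k, i) \<in> r} \<subset> {k. (k, j) \<in> r}"
      using r(2) that unfolding strict_linear_order_on_def trans_def irrefl_def by blast
    ultimately show ?thesis unfolding rank_in_def by (rule psubset_card_mono)
  qed
  have "i = j \<or> (i, j) \<in> r \<or> (j, i) \<in> r"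
    using r(2) i j unfolding strict_linear_order_on_def total_on_def by blast
  then show ?thesis using less[of i j] less[of j i] by auto
qed

lemma rank_in_less:
  assumes r: "r \<subseteq> {1..n} \<times> {1..n}" "strict_linear_order_on {1..n} r" and j: "j \<in> {1..n}"
  shows "rank_in r j < n"
proof -
  have "{i. (i, j) \<in> r} \<subseteq> {1..n} - {j}"
    using r unfolding strict_linear_order_on_def irrefl_def by blast
  then have "rank_in r j \<le> card ({1..n} - {j})"
    unfolding rank_in_def by (rule card_mono[rotated]) simp
  then show ?thesis using j by auto
qed

lemma order_of_rank_in:
  assumes r: "r \<subseteq> {1..n} \<times> {1..n}" "strict_linear_order_on {1..n} r"
  shows "order_of n (rank_in r) = r"
  using r(1) rank_in_less_iff[OF r] unfolding order_of_def by blast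

lemma inj_on_rank_in:
  assumes r: "r \<subseteq> {1..n} \<times> {1..n}" "strict_linear_order_on {1..n} r"
  shows "inj_on (rank_in r) {1..n}"
proof (rule inj_onI)
  fix i j assume ij: "i \<in> {1..n}" "j \<in> {1..n}" "rank_in r i = rank_in r j"
  then have "(i, j) \<notin> r" "(j, i) \<notin> r"
    using rank_in_less_iff[OF r, of i j] rank_in_less_iff[OF r, of j i] by auto
  then show "i = j"
    using r(2) ij(1,2) unfolding strict_linear_order_on_def total_on_def by blast
qed

lemma bij_betw_rank_in:
  assumes r: "r \<subseteq> {1..n} \<times> {1..n}" "strict_linear_order_on {1..n} r"
  shows "bij_betw (rank_in r) {1..n} {..<n}"
proof -
  have "rank_in r ` {1..n} \<subseteq> {..<n}" using rank_in_less[OF r] by blast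
  moreover have "card (rank_in r ` {1..n}) = card {..<n}"
    using card_image[OF inj_on_rank_in[OF r]] by simp
  ultimately have "rank_in r ` {1..n} = {..<n}" by (intro card_subset_eq) auto
  then show ?thesis using inj_on_rank_in[OF r] by (simp add: bij_betw_def)
qed

lemma strict_linear_order_order_of:
  assumes "inj_on v {1..n}"
  shows "order_of n v \<subseteq> {1..n} \<times> {1..n}" "strict_linear_order_on {1..n} (order_of n v)"
proof -
  show "order_of n v \<subseteq> {1..n} \<times> {1..n}" by (auto simp: order_of_def)
  have "total_on {1..n} (order_of n v)"
    unfolding total_on_def
  proof (intro ballI impI)
    fix i j assume "i \<in> {1..n}" "j \<in> {1..n}" "i \<noteq> j"
    then have "v i \<noteq> v j" using assms by (auto dest: inj_onD)
    then show "(i, j) \<in> order_of n v \<or> (j, i) \<in> order_of n v"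
      using \<open>i \<in> {1..n}\<close> \<open>j \<in> {1..n}\<close> by (auto simp: order_of_def)
  qed
  moreover have "trans (order_of n v)" "irrefl (order_of n v)"
    by (auto simp: order_of_def irrefl_def intro!: transI)
  ultimately show "strict_linear_order_on {1..n} (order_of n v)"
    by (simp add: strict_linear_order_on_def)
qed

lemma rank_in_order_of:
  assumes v: "bij_betw v {1..n} {..<n}" and j: "j \<in> {1..n}"
  shows "rank_in (order_of n v) j = v j"
proof -
  have "v ` {i\<in>{1..n}. v i < v j} = {..<v j}"
  proof
    show "{..<v j} \<subseteq> v ` {i\<in>{1..n}. v i < v j}"
    proof
      fix c assume c: "c \<in> {..<v j}"
      moreover have "v j < n" using bij_betwE[OF v] j by blast
      ultimately have "c \<in> v ` {1..n}" using v by (simp add: bij_betw_def)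
      then show "c \<in> v ` {i\<in>{1..n}. v i < v j}" using c by blast
    qed
  qed blast
  moreover have "inj_on v {i\<in>{1..n}. v i < v j}"
    by (rule inj_on_subset[OF bij_betw_imp_inj_on[OF v]]) blast
  ultimately have "card {i\<in>{1..n}. v i < v j} = card {..<v j}"
    by (metis card_image)
  moreover have "{i. (i, j) \<in> order_of n v} = {i\<in>{1..n}. v i < v j}"
    using j by (auto simp: order_of_def)
  ultimately show ?thesis by (simp add: rank_in_def)
qed

section \<open>The parking functions with a given run\<close>

lemma sorted_nth_less_iff_card:
  fixes s :: "nat list"
  assumes "sorted s" "j < length s"
  shows "s ! j < t \<longleftrightarrow> j < card {i\<in>{..<length s}. s ! i < t}"
proof
  assume "s ! j < t"
  then have "{..j} \<subseteq> {i\<in>{..<length s}. s ! i < t}"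
    using assms by (auto dest: sorted_nth_mono[of s _ j])
  then have "card {..j} \<le> card {i\<in>{..<length s}. s ! i < t}"
    by (intro card_mono) auto
  then show "j < card {i\<in>{..<length s}. s ! i < t}" by simp
next
  assume j: "j < card {i\<in>{..<length s}. s ! i < t}"
  show "s ! j < t"
  proof (rule ccontr)
    assume "\<not> s ! j < t"
    then have "i < j" if "i < length s" "s ! i < t" for i
      using that sorted_nth_mono[OF assms(1), of j i] by (cases "j \<le> i") auto
    then have "{i\<in>{..<length s}. s ! i < t} \<subseteq> {..<j}" by auto
    then show False using j card_mono[of "{..<j}" "{i\<in>{..<length s}. s ! i < t}"] by simp
  qed
qed

lemma card_nth_less_sort:
  "card {i\<in>{..<length s}. sort s ! i < t} = card {i\<in>{..<length s}. (s :: nat list) ! i < t}"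
proof -
  have "length (filter (\<lambda>y. y < t) (sort s)) = length (filter (\<lambda>y. y < t) s)"
    by (metis filter_sort length_sort)
  then show ?thesis by (simp add: length_filter_conv_card)
qed

text \<open>
  The form of the parking condition that the search uses, without rearranging the list.
\<close>

lemma PF_iff_card:
  "\<alpha> \<in> PF n x \<longleftrightarrow> length \<alpha> = n \<and>
     (\<forall>m<n. m < card {c\<in>{..<n}. \<alpha> ! c < (\<Sum>u\<le>m. x (Suc u))})"
proof -
  have shift: "(\<Sum>k=1..Suc m. x k) = (\<Sum>u\<le>m. x (Suc u))" for m
    by (induction m) simp_all
  have "(\<forall>j\<in>{1..n}. int (sort \<alpha> ! (j - 1)) \<le> int (\<Sum>k=1..j. x k) - 1) \<longleftrightarrow>
    (\<forall>m<n. sort \<alpha> ! m < (\<Sum>u\<le>m. x (Suc u)))"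
  proof -
    have "{1..n} = Suc ` {..<n}" by (simp add: image_Suc_lessThan)
    then have "(\<forall>j\<in>{1..n}. P j) \<longleftrightarrow> (\<forall>m<n. P (Suc m))" for P
      by auto
    moreover have "int y \<le> int z - 1 \<longleftrightarrow> y < z" for y z by linarith
    ultimately show ?thesis by (simp only: shift diff_Suc_1)
  qed
  moreover have "sort \<alpha> ! m < t \<longleftrightarrow> m < card {c\<in>{..<n}. \<alpha> ! c < t}"
    if "length \<alpha> = n" "m < n" for m t
    using sorted_nth_less_iff_card[of "sort \<alpha>" m t] card_nth_less_sort[of \<alpha> t] that by simp
  ultimately show ?thesis unfolding PF_def by auto
qed

text \<open>
  If \<open>v\<close> lists all labels, then each entry is confined to an interval, independently of the others,
  so this is a box.
\<close>

definition run_box :: "nat \<Rightarrow> (nat \<Rightarrow> nat) \<Rightarrow> (nat \<Rightarrow> nat) \<Rightarrow> (nat \<Rightarrow> nat) \<Rightarrow> nat list set" where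
  "run_box n wt f v = {\<alpha>. length \<alpha> = n \<and> (\<forall>k<n. burns_to wt ((!) \<alpha>) f v k)}"

lemma all_unvisited_iff_bij_betw:
  "(\<forall>k<n. v (Suc k) \<in> unvisited n v k) \<longleftrightarrow> bij_betw v {1..n} {..<n}"
proof
  assume unv: "\<forall>k<n. v (Suc k) \<in> unvisited n v k"
  have ne: "v j \<noteq> v i" if ij: "0 < i" "i < j" "j \<le> n" for i j
  proof -
    obtain k where k: "j = Suc k" using ij by (cases j) auto
    then have "v j \<notin> v ` {1..k}" using unv ij by (auto simp: unvisited_def)
    moreover have "i \<in> {1..k}" using k ij by simp
    ultimately show ?thesis by blast
  qed
  have inj: "inj_on v {1..n}"
  proof (rule inj_onI)
    fix i j assume "i \<in> {1..n}" "j \<in> {1..n}" "v i = v j"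
    then show "i = j"
      using ne[of i j] ne[of j i] by (cases i j rule: linorder_cases) auto
  qed
  have "v j < n" if "j \<in> {1..n}" for j
    using unv that by (cases j) (auto simp: unvisited_def)
  then have "v ` {1..n} \<subseteq> {..<n}" by blast
  moreover have "card (v ` {1..n}) = card {..<n}" using card_image[OF inj] by simp
  ultimately have "v ` {1..n} = {..<n}" by (intro card_subset_eq) auto
  with inj show "bij_betw v {1..n} {..<n}" by (simp add: bij_betw_def)
next
  assume v: "bij_betw v {1..n} {..<n}"
  show "\<forall>k<n. v (Suc k) \<in> unvisited n v k"
  proof (intro allI impI)
    fix k assume k: "k < n"
    have "v (Suc k) < n" using bij_betwE[OF v] k by auto
    moreover have "v (Suc k) \<noteq> v i" if "i \<in> {1..k}" for i
      using inj_onD[OF bij_betw_imp_inj_on[OF v], of "Suc k" i] k that by auto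
    ultimately show "v (Suc k) \<in> unvisited n v k"
      unfolding unvisited_def lessThan_def by blast
  qed
qed

text \<open>
  When all labels are visited, nothing is left of the requirement on unvisited labels.
\<close>

lemma burning_full_iff:
  "burning n wt ((!) \<alpha>) f v n \<and> length \<alpha> = n \<longleftrightarrow>
     bij_betw v {1..n} {..<n} \<and> dfs_run n f v \<and> \<alpha> \<in> run_box n wt f v"
proof -
  have "unvisited n v n = {}" if "bij_betw v {1..n} {..<n}"
    using that by (simp add: unvisited_def bij_betw_def)
  moreover have "burning n wt ((!) \<alpha>) f v n \<longleftrightarrow> bij_betw v {1..n} {..<n} \<and> dfs_run n f v \<and>
      (\<forall>k<n. burns_to wt ((!) \<alpha>) f v k) \<and>
      (\<forall>c\<in>unvisited n v n. sum wt {..n} \<le> \<alpha> ! c + sum wt (pending f v c n))"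
    unfolding burning_def dfs_run_def all_unvisited_iff_bij_betw[symmetric] by blast
  ultimately show ?thesis unfolding run_box_def by blast
qed

lemma run_box_in_PF:
  assumes v: "bij_betw v {1..n} {..<n}" and \<alpha>: "\<alpha> \<in> run_box n (\<lambda>u. x (Suc u)) f v"
  shows "\<alpha> \<in> PF n x"
  unfolding PF_iff_card
proof (intro conjI allI impI)
  let ?K = "\<lambda>m. \<Sum>u\<le>m. x (Suc u)"
  show "length \<alpha> = n" using \<alpha> by (simp add: run_box_def)
  fix m assume m: "m < n"
  have "\<alpha> ! v j < ?K m" if j: "j \<in> {1..Suc m}" for j
  proof -
    obtain k where k: "j = Suc k" "k \<le> m" using j by (cases j) auto
    have "burns_to (\<lambda>u. x (Suc u)) ((!) \<alpha>) f v k" using \<alpha> k m by (simp add: run_box_def)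
    then have "\<alpha> ! v j < ?K k" unfolding burns_to_def Let_def k by linarith
    also have "?K k \<le> ?K m" using k by (intro sum_mono2) auto
    finally show ?thesis .
  qed
  moreover have "v j < n" if "j \<in> {1..Suc m}" for j
    using bij_betwE[OF v] that m by auto
  ultimately have "v ` {1..Suc m} \<subseteq> {c\<in>{..<n}. \<alpha> ! c < ?K m}" by auto
  then have "card (v ` {1..Suc m}) \<le> card {c\<in>{..<n}. \<alpha> ! c < ?K m}"
    by (intro card_mono) simp_all
  moreover have "inj_on v {1..Suc m}"
    by (rule inj_on_subset[OF bij_betw_imp_inj_on[OF v]]) (use m in auto)
  ultimately show "m < card {c\<in>{..<n}. \<alpha> ! c < ?K m}"
    by (simp add: card_image)
qed

text \<open>
  The sum of \<open>(n + 1 - i) * x i\<close> over \<open>i\<close> is the sum of the partial sums of \<open>x\<close>, and the vertex visited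
  at time \<open>k + 1\<close> can be paired with the partial sum of length \<open>k + 1\<close>, which bounds its entry.
\<close>

lemma rsum_eq_sum_slack:
  assumes v: "bij_betw v {1..n} {..<n}" and \<alpha>: "\<alpha> \<in> run_box n (\<lambda>u. x (Suc u)) f v"
  shows "nat (rsum n x \<alpha>) = (\<Sum>k<n. (\<Sum>u\<le>k. x (Suc u)) - 1 - \<alpha> ! v (Suc k))"
proof -
  let ?K = "\<lambda>m. \<Sum>u\<le>m. x (Suc u)"
  have len: "length \<alpha> = n" using \<alpha> by (simp add: run_box_def)
  have less: "\<alpha> ! v (Suc k) < ?K k" if "k < n" for k
  proof -
    have "burns_to (\<lambda>u. x (Suc u)) ((!) \<alpha>) f v k" using \<alpha> that by (simp add: run_box_def)
    then show ?thesis unfolding burns_to_def Let_def by linarith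
  qed
  have "(\<Sum>i=1..n. (int n + 1 - int i) * int (x i)) = (\<Sum>k<n. int (?K k))"
  proof (induction n)
    case (Suc n)
    have "(\<Sum>i=1..Suc n. (int (Suc n) + 1 - int i) * int (x i)) =
        (\<Sum>i=1..Suc n. (int n + 1 - int i) * int (x i)) + (\<Sum>i=1..Suc n. int (x i))"
      by (simp only: sum.distrib[symmetric]) (simp add: algebra_simps)
    also have "(\<Sum>i=1..Suc n. (int n + 1 - int i) * int (x i)) = (\<Sum>k<n. int (?K k))"
      using Suc by simp
    also have "(\<Sum>i=1..Suc n. int (x i)) = int (?K n)"
      by (induction n) simp_all
    finally show ?case by simp
  qed simp
  moreover have "sum_list \<alpha> = (\<Sum>k<n. \<alpha> ! v (Suc k))"
  proof -
    have "sum_list \<alpha> = (\<Sum>c<n. \<alpha> ! c)" by (simp add: sum_list_sum_nth len atLeast0LessThan)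
    also have "\<dots> = (\<Sum>j=1..n. \<alpha> ! v j)" by (rule sum.reindex_bij_betw[OF v, symmetric])
    finally show ?thesis by (simp add: sum.atLeast1_atMost_eq)
  qed
  ultimately have "rsum n x \<alpha> = (\<Sum>k<n. int (?K k) - 1 - int (\<alpha> ! v (Suc k)))"
    by (simp add: rsum_def sum_subtractf)
  also have "\<dots> = (\<Sum>k<n. int (?K k - 1 - \<alpha> ! v (Suc k)))"
    using less by (intro sum.cong refl) (simp add: of_nat_diff Suc_le_eq)
  finally show ?thesis by (metis nat_int of_nat_sum)
qed

lemma sum_qvar_interval:
  fixes I K w :: nat
  assumes "I + w \<le> K"
  shows "(\<Sum>y | y + I < K \<and> K \<le> y + (I + w). qvar ^ (K - 1 - y)) = qvar ^ I * qint w"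
proof -
  have "(\<Sum>y | y + I < K \<and> K \<le> y + (I + w). qvar ^ (K - 1 - y)) = (\<Sum>t<w. qvar ^ (I + t))"
    by (rule sum.reindex_bij_witness[of _ "\<lambda>t. K - 1 - I - t" "\<lambda>y. K - 1 - y - I"])
      (use assms in auto)
  then show ?thesis by (simp add: qint_def power_add sum_distrib_left)
qed

text \<open>
  The sum over a box is a product of sums over intervals. The interval for the vertex \<open>j\<close> has as many
  elements as the weight of its parent, and its least slack is the total weight of the vertices
  that never examine the label of \<open>j\<close>.
\<close>

lemma sum_run_box:
  assumes v: "bij_betw v {1..n} {..<n}" and run: "dfs_run n f v"
  shows "(\<Sum>\<alpha>\<in>run_box n (\<lambda>u. x (Suc u)) f v. qvar ^ nat (rsum n x \<alpha>)) =
    (\<Prod>j=1..n. qvar ^ (\<Sum>i\<in>inversions f v j. x (Suc (f i))) * qint (x (Suc (f j))))"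
proof -
  let ?wt = "\<lambda>u. x (Suc u)"
  let ?K = "\<lambda>k. sum ?wt {..k}"
  define I where "I k = (\<Sum>i\<in>inversions f v (Suc k). ?wt (f i))" for k
  define J where "J k = {y. y + I k < ?K k \<and> ?K k \<le> y + (I k + ?wt (f (Suc k)))}" for k
  have run_Suc: "dfs_run (Suc k) f v" if "k < n" for k
    using run that by (simp add: dfs_run_def)
  have below: "sum ?wt {u\<in>pending f v (v (Suc k)) k. u < f (Suc k)} = I k" if "k < n" for k
    unfolding I_def by (rule sum_pending_below_parent[OF run_Suc[OF that]])
  have upto: "sum ?wt {u\<in>pending f v (v (Suc k)) k. u \<le> f (Suc k)} = I k + ?wt (f (Suc k))"
    if k: "k < n" for k
  proof -
    have "f (Suc k) \<in> pending f v (v (Suc k)) k" using run k by (simp add: dfs_run_def)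
    then have "{u\<in>pending f v (v (Suc k)) k. u \<le> f (Suc k)} =
        insert (f (Suc k)) {u\<in>pending f v (v (Suc k)) k. u < f (Suc k)}" by auto
    then show ?thesis using below[OF k] by simp
  qed
  have le: "I k + ?wt (f (Suc k)) \<le> ?K k" if k: "k < n" for k
    unfolding upto[OF k, symmetric]
    using pending_subset[of f v "v (Suc k)" k] by (intro sum_mono2) auto
  have box: "\<alpha> \<in> run_box n ?wt f v \<longleftrightarrow> length \<alpha> = n \<and> (\<forall>k<n. \<alpha> ! v (Suc k) \<in> J k)" for \<alpha>
    by (auto simp: run_box_def burns_to_def Let_def J_def below upto)
  have finJ: "finite (J k)" for k
    by (rule finite_subset[of _ "{..<?K k}"]) (auto simp: J_def)
  \<comment> \<open>Entry \<open>\<rho> k\<close> of the list belongs to vertex \<open>k + 1\<close>; the box is a product over the vertices.\<close>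
  define \<rho> where "\<rho> k = v (Suc k)" for k
  have "bij_betw Suc {..<n} {1..n}" by (simp add: bij_betw_def image_Suc_lessThan)
  then have "bij_betw (v \<circ> Suc) {..<n} {..<n}" using v by (rule bij_betw_trans)
  moreover have "v \<circ> Suc = \<rho>" by (simp add: \<rho>_def fun_eq_iff)
  ultimately have \<rho>: "bij_betw \<rho> {..<n} {..<n}" by simp
  define \<tau> where "\<tau> = the_inv_into {..<n} \<rho>"
  have \<tau>\<rho>: "\<tau> (\<rho> k) = k" if "k < n" for k
    unfolding \<tau>_def using that by (intro the_inv_into_f_f bij_betw_imp_inj_on[OF \<rho>]) simp
  have \<rho>\<tau>: "\<rho> (\<tau> c) = c" "\<tau> c < n" if "c < n" for c
  proof -
    show "\<rho> (\<tau> c) = c" unfolding \<tau>_def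
      using that \<rho> by (intro f_the_inv_into_f_bij_betw) auto
    show "\<tau> c < n" using bij_betwE[OF bij_betw_the_inv_into[OF \<rho>]] that by (simp add: \<tau>_def)
  qed
  have \<rho>_less: "\<rho> k < n" if "k < n" for k using bij_betwE[OF \<rho>] that by simp
  have "(\<Sum>\<alpha>\<in>run_box n ?wt f v. qvar ^ nat (rsum n x \<alpha>)) =
      (\<Sum>\<alpha>\<in>run_box n ?wt f v. \<Prod>k<n. qvar ^ (?K k - 1 - \<alpha> ! \<rho> k))"
    by (intro sum.cong refl) (simp add: rsum_eq_sum_slack[OF v] power_sum \<rho>_def)
  also have "\<dots> = (\<Sum>g\<in>PiE {..<n} J. \<Prod>k<n. qvar ^ (?K k - 1 - g k))"
  proof (rule sum.reindex_bij_witness[of _ "\<lambda>g. map (\<lambda>c. g (\<tau> c)) [0..<n]"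
        "\<lambda>\<alpha>. \<lambda>k\<in>{..<n}. \<alpha> ! \<rho> k"])
    fix \<alpha> assume \<alpha>: "\<alpha> \<in> run_box n ?wt f v"
    then show "map (\<lambda>c. (\<lambda>k\<in>{..<n}. \<alpha> ! \<rho> k) (\<tau> c)) [0..<n] = \<alpha>"
      by (intro nth_equalityI) (simp_all add: box \<rho>\<tau>)
    show "(\<lambda>k\<in>{..<n}. \<alpha> ! \<rho> k) \<in> PiE {..<n} J"
      using \<alpha> by (intro restrict_PiE_iff[THEN iffD2]) (simp add: box \<rho>_def)
    show "(\<Prod>k<n. qvar ^ (?K k - 1 - (\<lambda>k\<in>{..<n}. \<alpha> ! \<rho> k) k)) =
        (\<Prod>k<n. qvar ^ (?K k - 1 - \<alpha> ! \<rho> k))"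
      by (intro prod.cong refl) simp
  next
    fix g assume g: "g \<in> PiE {..<n} J"
    show "(\<lambda>k\<in>{..<n}. map (\<lambda>c. g (\<tau> c)) [0..<n] ! \<rho> k) = g"
    proof
      fix k
      show "(\<lambda>k\<in>{..<n}. map (\<lambda>c. g (\<tau> c)) [0..<n] ! \<rho> k) k = g k"
        using PiE_arb[OF g, of k] \<rho>_less[of k] \<tau>\<rho>[of k] by (cases "k < n") simp_all
    qed
    show "map (\<lambda>c. g (\<tau> c)) [0..<n] \<in> run_box n ?wt f v"
      unfolding box
    proof (intro conjI allI impI)
      fix k assume k: "k < n"
      have "map (\<lambda>c. g (\<tau> c)) [0..<n] ! v (Suc k) = g k"
        using \<rho>_less[OF k] \<tau>\<rho>[OF k] by (simp add: \<rho>_def)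
      then show "map (\<lambda>c. g (\<tau> c)) [0..<n] ! v (Suc k) \<in> J k"
        using PiE_mem[OF g, of k] k by simp
    qed simp
  qed
  also have "\<dots> = (\<Prod>k<n. \<Sum>y\<in>J k. qvar ^ (?K k - 1 - y))"
    by (rule prod_sum_PiE[symmetric]) (simp_all add: finJ)
  also have "\<dots> = (\<Prod>k<n. qvar ^ I k * qint (?wt (f (Suc k))))"
    unfolding J_def by (intro prod.cong refl sum_qvar_interval le) simp
  also have "\<dots> = (\<Prod>j=1..n. qvar ^ (\<Sum>i\<in>inversions f v j. x (Suc (f i))) * qint (x (Suc (f j))))"
    by (simp add: prod.atLeast1_atMost_eq I_def)
  finally show ?thesis .
qed

section \<open>The identity\<close>

lemma AVO_D:
  assumes "r \<in> AVO n T"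
  shows "r \<subseteq> {1..n} \<times> {1..n}" "strict_linear_order_on {1..n} r"
    "0 < i \<Longrightarrow> i < j \<Longrightarrow> j \<le> n \<Longrightarrow> par T i = par T j \<Longrightarrow> (j, i) \<in> r"
proof -
  show "r \<subseteq> {1..n} \<times> {1..n}" "strict_linear_order_on {1..n} r"
    using assms unfolding AVO_def by blast+
  have "\<forall>i\<in>{1..n}. \<forall>j\<in>{1..n}. i < j \<and> par T i = par T j \<longrightarrow> (j, i) \<in> r"
    using assms unfolding AVO_def by blast
  then show "0 < i \<Longrightarrow> i < j \<Longrightarrow> j \<le> n \<Longrightarrow> par T i = par T j \<Longrightarrow> (j, i) \<in> r"
    by simp
qed

lemma dfs_run_rank_in:
  assumes T: "T \<in> rooted_plane_trees n" and r: "r \<in> AVO n T"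
  shows "dfs_run n (par T) (rank_in r)"
  unfolding dfs_run_iff
proof (intro conjI allI impI)
  fix i j assume ij: "0 < i" "i < j" "j \<le> n" "par T i = par T j"
  then show "rank_in r j < rank_in r i"
    using rank_in_less_iff[OF AVO_D(1,2)[OF r], of j i] AVO_D(3)[OF r ij] by simp
qed (rule plane_parent_par[OF T])

lemma inversions_rank_in:
  assumes T: "T \<in> rooted_plane_trees n" and r: "r \<in> AVO n T" and j: "j \<in> {1..n}"
  shows "inversions (par T) (rank_in r) j = {i. i \<in> {1..n} \<and> tree_le T i j \<and> (j, i) \<in> r}"
proof -
  note dec = parents_smaller_par[OF T]
  have "anc (par T) i j \<longleftrightarrow> tree_le T i j" for i
    using tree_le_iff_anc[OF rooted_plane_treesD(1)[OF T] dec] j by simp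
  moreover have "anc (par T) i j \<Longrightarrow> i \<le> n" for i using anc_le[OF dec, of i j] j by simp
  moreover have "rank_in r j < rank_in r i \<longleftrightarrow> (j, i) \<in> r" if "0 < i" "i \<le> n" for i
    using rank_in_less_iff[OF AVO_D(1,2)[OF r] j, of i] that by simp
  ultimately show ?thesis unfolding inversions_def by (auto simp: Suc_le_eq)
qed

lemma prod_parents_eq_prod_outdeg:
  fixes g :: "nat \<Rightarrow> 'a :: comm_monoid_mult"
  assumes "parents_smaller n (par T)"
  shows "(\<Prod>j=1..n. g (Suc (par T j))) = (\<Prod>i=1..n. g i ^ outdeg n T (i - 1))"
proof -
  have "(\<lambda>j. Suc (par T j)) ` {1..n} \<subseteq> {1..n}"
    using assms by (auto simp: parents_smaller_def Suc_le_eq intro: less_le_trans)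
  then have "(\<Prod>j=1..n. g (Suc (par T j))) =
      (\<Prod>i=1..n. \<Prod>j\<in>{j\<in>{1..n}. Suc (par T j) = i}. g (Suc (par T j)))"
    by (intro prod.group[symmetric]) auto
  also have "\<dots> = (\<Prod>i=1..n. g i ^ outdeg n T (i - 1))"
  proof (rule prod.cong[OF refl])
    fix i assume "i \<in> {1..n}"
    then have "{j\<in>{1..n}. Suc (par T j) = i} = {j\<in>{1..n}. par T j = i - 1}" by auto
    moreover have "(\<Prod>j\<in>{j\<in>{1..n}. Suc (par T j) = i}. g (Suc (par T j))) =
        (\<Prod>j\<in>{j\<in>{1..n}. Suc (par T j) = i}. g i)"
      by (rule prod.cong) auto
    ultimately show "(\<Prod>j\<in>{j\<in>{1..n}. Suc (par T j) = i}. g (Suc (par T j))) =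
        g i ^ outdeg n T (i - 1)"
      by (simp add: outdeg_def)
  qed
  finally show ?thesis .
qed

lemma sum_run_box_tree:
  assumes T: "T \<in> rooted_plane_trees n" and r: "r \<in> AVO n T"
  shows "(\<Sum>\<alpha>\<in>run_box n (\<lambda>u. x (Suc u)) (par T) (rank_in r). qvar ^ nat (rsum n x \<alpha>)) =
    qvar ^ (\<Sum>(i, j)\<in>{(i, j). i \<in> {1..n} \<and> j \<in> {1..n} \<and> tree_le T i j \<and> (j, i) \<in> r}.
              x (par T i + 1))
    * (\<Prod>i=1..n. qint (x i) ^ outdeg n T (i - 1))"
proof -
  let ?inv = "\<lambda>j. {i. i \<in> {1..n} \<and> tree_le T i j \<and> (j, i) \<in> r}"
  have "(\<Sum>(i, j)\<in>{(i, j). i \<in> {1..n} \<and> j \<in> {1..n} \<and> tree_le T i j \<and> (j, i) \<in> r}.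
      x (par T i + 1)) = (\<Sum>(j, i)\<in>(SIGMA j:{1..n}. ?inv j). x (Suc (par T i)))"
    by (rule sum.reindex_bij_witness[of _ prod.swap prod.swap]) auto
  also have "\<dots> = (\<Sum>j=1..n. \<Sum>i\<in>?inv j. x (Suc (par T i)))"
    by (rule sum.Sigma[symmetric]) auto
  also have "\<dots> = (\<Sum>j=1..n. \<Sum>i\<in>inversions (par T) (rank_in r) j. x (Suc (par T i)))"
    by (intro sum.cong refl) (simp add: inversions_rank_in[OF T r])
  finally show ?thesis
    using sum_run_box[OF bij_betw_rank_in[OF AVO_D(1,2)[OF r]] dfs_run_rank_in[OF T r], of x]
      prod_parents_eq_prod_outdeg[OF parents_smaller_par[OF T], of "\<lambda>i. qint (x i)"]
    by (simp add: prod.distrib power_sum)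
qed

lemma PF_in_some_run_box:
  assumes "\<alpha> \<in> PF n x"
  shows "\<exists>T r. T \<in> rooted_plane_trees n \<and> r \<in> AVO n T \<and>
    \<alpha> \<in> run_box n (\<lambda>u. x (Suc u)) (par T) (rank_in r)"
proof -
  let ?wt = "\<lambda>u. x (Suc u)"
  have \<alpha>: "length \<alpha> = n" "\<And>m. m < n \<Longrightarrow> m < card {c\<in>{..<n}. \<alpha> ! c < sum ?wt {..m}}"
    using assms unfolding PF_iff_card by blast+
  obtain f v where "burning n ?wt ((!) \<alpha>) f v n"
    using burning_exists[OF \<alpha>(2) order_refl] by blast
  then have v: "bij_betw v {1..n} {..<n}" and run: "dfs_run n f v"
    and box: "\<alpha> \<in> run_box n ?wt f v"
    using burning_full_iff \<alpha>(1) by blast+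
  have plane: "plane_parent n f"
    and siblings: "\<And>i j. 0 < i \<Longrightarrow> i < j \<Longrightarrow> j \<le> n \<Longrightarrow> f i = f j \<Longrightarrow> v j < v i"
    using run unfolding dfs_run_iff by blast+
  note dec = plane_parent_parents_smaller[OF plane]
  let ?T = "parent_edges n f" and ?r = "order_of n v"
  note par = par_parent_edges[OF dec]
  have "(j, i) \<in> ?r" if "i \<in> {1..n}" "j \<in> {1..n}" "i < j \<and> par ?T i = par ?T j" for i j
    using that par[of i] par[of j] siblings[of i j] by (simp add: order_of_def)
  then have "?r \<in> AVO n ?T"
    unfolding AVO_def using strict_linear_order_order_of[OF bij_betw_imp_inj_on[OF v]] by blast
  moreover have "\<alpha> \<in> run_box n ?wt (par ?T) (rank_in ?r)"
  proof -
    have "burning n ?wt ((!) \<alpha>) (par ?T) (rank_in ?r) n"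
      using \<open>burning n ?wt ((!) \<alpha>) f v n\<close> par rank_in_order_of[OF v]
      by (subst burning_cong[of n _ f _ v]) simp_all
    then show ?thesis using burning_full_iff \<alpha>(1) by blast
  qed
  ultimately show ?thesis using parent_edges_rooted_plane_tree[OF plane] by blast
qed

lemma run_box_determines_tree_and_order:
  assumes T: "T \<in> rooted_plane_trees n" and r: "r \<in> AVO n T"
    and T': "T' \<in> rooted_plane_trees n" and r': "r' \<in> AVO n T'"
    and \<alpha>: "\<alpha> \<in> run_box n wt (par T) (rank_in r)" "\<alpha> \<in> run_box n wt (par T') (rank_in r')"
  shows "T = T' \<and> r = r'"
proof -
  note o = AVO_D(1,2)[OF r] and o' = AVO_D(1,2)[OF r']
  have "burning n wt ((!) \<alpha>) (par T) (rank_in r) n"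
    using burning_full_iff bij_betw_rank_in[OF o] dfs_run_rank_in[OF T r] \<alpha>(1) by blast
  moreover have "burning n wt ((!) \<alpha>) (par T') (rank_in r') n"
    using burning_full_iff bij_betw_rank_in[OF o'] dfs_run_rank_in[OF T' r'] \<alpha>(2) by blast
  ultimately have eq: "par T j = par T' j \<and> rank_in r j = rank_in r' j" if "j \<in> {1..n}" for j
    using burning_unique[of n wt "(!) \<alpha>" "par T" "rank_in r" n "par T'" "rank_in r'" j] that
    by simp
  have "parent_edges n (par T) = parent_edges n (par T')"
    unfolding parent_edges_def by (rule image_cong) (simp_all add: eq)
  moreover have "order_of n (rank_in r) = order_of n (rank_in r')"
    unfolding order_of_def using eq by auto
  ultimately show ?thesis
    using tree_eq_parent_edges[OF rooted_plane_treesD(1)[OF T]]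
      tree_eq_parent_edges[OF rooted_plane_treesD(1)[OF T']]
      order_of_rank_in[OF o] order_of_rank_in[OF o'] by simp
qed

lemma finite_rooted_plane_trees: "finite (rooted_plane_trees n)"
  by (rule finite_subset[of _ "Pow (Pow {0..n})"])
    (auto simp: rooted_plane_trees_def is_tree_def)

lemma finite_AVO: "finite (AVO n T)"
  by (rule finite_subset[of _ "Pow ({1..n} \<times> {1..n})"]) (auto simp: AVO_def)

lemma finite_run_box: "finite (run_box n wt f v)" if "bij_betw v {1..n} {..<n}"
proof (rule finite_subset)
  show "run_box n wt f v \<subseteq> {\<alpha>. set \<alpha> \<subseteq> {..<sum wt {..n}} \<and> length \<alpha> = n}"
  proof
    fix \<alpha> assume \<alpha>: "\<alpha> \<in> run_box n wt f v"
    then have len: "length \<alpha> = n" by (simp add: run_box_def)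
    have "\<alpha> ! c < sum wt {..n}" if "c < n" for c
    proof -
      have "c \<in> v ` {1..n}" using that \<open>bij_betw v {1..n} {..<n}\<close> by (simp add: bij_betw_def)
      then obtain j where "j \<in> {1..n}" "c = v j" by blast
      then obtain k where k: "k < n" "c = v (Suc k)" by (cases j) (auto simp: Suc_le_eq)
      have "burns_to wt ((!) \<alpha>) f v k" using \<alpha> k by (simp add: run_box_def)
      then have "\<alpha> ! c < sum wt {..k}" unfolding burns_to_def Let_def k by linarith
      also have "\<dots> \<le> sum wt {..n}" using k by (intro sum_mono2) auto
      finally show ?thesis .
    qed
    with len show "\<alpha> \<in> {\<alpha>. set \<alpha> \<subseteq> {..<sum wt {..n}} \<and> length \<alpha> = n}"
      by (auto simp: in_set_conv_nth)
  qed
qed (rule finite_lists_length_eq, simp)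

text \<open>
  The boxes of the pairs of a tree and an admissible order partition the parking functions.
\<close>

theorem theorem1p8:
  fixes n :: nat and x :: "nat \<Rightarrow> nat"
  assumes "n \<ge> 1"
  shows "(\<Sum>\<alpha>\<in>PF n x. qvar ^ nat (rsum n x \<alpha>)) =
    (\<Sum>T\<in>rooted_plane_trees n.
       (\<Sum>r\<in>AVO n T.
          qvar ^ (\<Sum>(i, j)\<in>{(i, j). i \<in> {1..n} \<and> j \<in> {1..n} \<and> tree_le T i j \<and> (j, i) \<in> r}.
                    x (par T i + 1)))
       * (\<Prod>i=1..n. qint (x i) ^ outdeg n T (i - 1)))"
proof -
  let ?box = "\<lambda>(T, r). run_box n (\<lambda>u. x (Suc u)) (par T) (rank_in r)"
  let ?runs = "SIGMA T:rooted_plane_trees n. AVO n T"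
  let ?q = "\<lambda>\<alpha>. qvar ^ nat (rsum n x \<alpha>)"
  have bij: "bij_betw (rank_in r) {1..n} {..<n}" if "r \<in> AVO n T" for T r
    by (rule bij_betw_rank_in[OF AVO_D(1,2)[OF that]])
  have PF: "PF n x = (\<Union>p\<in>?runs. ?box p)"
  proof
    show "PF n x \<subseteq> (\<Union>p\<in>?runs. ?box p)" using PF_in_some_run_box by fast
    show "(\<Union>p\<in>?runs. ?box p) \<subseteq> PF n x" using run_box_in_PF[OF bij] by blast
  qed
  have "sum ?q (PF n x) = (\<Sum>p\<in>?runs. sum ?q (?box p))"
    unfolding PF
  proof (rule sum.UNION_disjoint)
    show "finite ?runs" by (intro finite_SigmaI finite_rooted_plane_trees finite_AVO)
    show "\<forall>p\<in>?runs. finite (?box p)" using finite_run_box[OF bij] by auto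
    show "\<forall>p\<in>?runs. \<forall>p'\<in>?runs. p \<noteq> p' \<longrightarrow> ?box p \<inter> ?box p' = {}"
      using run_box_determines_tree_and_order by fast
  qed
  also have "\<dots> = (\<Sum>T\<in>rooted_plane_trees n. \<Sum>r\<in>AVO n T. sum ?q (?box (T, r)))"
    by (simp add: sum.Sigma finite_rooted_plane_trees finite_AVO split_def)
  also have "\<dots> = (\<Sum>T\<in>rooted_plane_trees n.
       (\<Sum>r\<in>AVO n T.
          qvar ^ (\<Sum>(i, j)\<in>{(i, j). i \<in> {1..n} \<and> j \<in> {1..n} \<and> tree_le T i j \<and> (j, i) \<in> r}.
                    x (par T i + 1)))
       * (\<Prod>i=1..n. qint (x i) ^ outdeg n T (i - 1)))"
    unfolding sum_distrib_right by (intro sum.cong refl) (simp add: sum_run_box_tree)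
  finally show ?thesis .
qed

end
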